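(* Let $p>0$ and let $F:\Omega_1\to\Omega_2$ be a biholomorphic mapping between bounded simply-connected domains in $\mathbb C^n$. Then for all $z\in\Omega_1$ and all $X=\sum_jX_j\,\partial/\partial z_j$ with $(X_1,\dots,X_n)\in\mathbb C^n$, $$B_{\Omega_1,p}(z;X)=B_{\Omega_2,p}(F(z);F_*X).$$ Moreover, this equality holds for arbitrary bounded domains (not necessarily simply-connected) whenever $2/p$ is a positive integer.
   Context: For a bounded domain $\Omega\subset\mathbb C^n$ and $p>0$, $A^p(\Omega)$ is the space of holomorphic functions $f$ on $\Omega$ with $\|f\|_p^p:=\int_\Omega|f|^p<\infty$ (Lebesgue measure), $m_p(z):=\inf\{\|f\|_p: f\in A^p(\Omega),\ f(z)=1\}$, $K_p(z):=m_p(z)^{-p}$, and the $p$-Bergman metric is $B_{\Omega,p}(z;X)=B_p(z;X):=K_p(z)^{-1/p}\cdot\sup\{|Xf(z)|: f\in A^p(\Omega),\ f(z)=0,\ \|f\|_p=1\}$, where $Xf=\sum_jX_j\,\partial f/\partial z_j$. $F_*X$ is the push-forward of the tangent vector $X$ at $z$ by $F$. *)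

theory Defs
  imports "HOL-Analysis.Analysis"
begin

definition bounded_domain :: "(complex ^ 'n) set \<Rightarrow> bool" where
  "bounded_domain \<Omega> \<longleftrightarrow> open \<Omega> \<and> connected \<Omega> \<and> \<Omega> \<noteq> {} \<and> bounded \<Omega>"

text \<open>
  The library's holomorphic functions are those of one variable. In several variables,
  holomorphic means here that the real total derivative exists at each point and is
  complex linear, i.e. of the form \<open>h \<mapsto> \<Sum>\<^sub>j a\<^sub>j h\<^sub>j\<close>. It is meant for open \<open>\<Omega>\<close>.
\<close>
definition mholomorphic_on :: "(complex ^ 'n \<Rightarrow> complex) \<Rightarrow> (complex ^ 'n) set \<Rightarrow> bool"
    (infixl "mholomorphic'_on" 50) where
  "f mholomorphic_on \<Omega> \<longleftrightarrow>
     (\<forall>z\<in>\<Omega>. \<exists>a :: complex ^ 'n. (f has_derivative (\<lambda>h. \<Sum>j\<in>UNIV. a $ j * h $ j)) (at z))"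

definition holomorphic_map_on :: "(complex ^ 'n \<Rightarrow> complex ^ 'm) \<Rightarrow> (complex ^ 'n) set \<Rightarrow> bool" where
  "holomorphic_map_on F \<Omega> \<longleftrightarrow> (\<forall>k. (\<lambda>z. F z $ k) mholomorphic_on \<Omega>)"

definition biholomorphic_map ::
    "(complex ^ 'n \<Rightarrow> complex ^ 'n) \<Rightarrow> (complex ^ 'n) set \<Rightarrow> (complex ^ 'n) set \<Rightarrow> bool" where
  "biholomorphic_map F \<Omega>1 \<Omega>2 \<longleftrightarrow>
     bij_betw F \<Omega>1 \<Omega>2 \<and> holomorphic_map_on F \<Omega>1 \<and>
     holomorphic_map_on (inv_into \<Omega>1 F) \<Omega>2"

definition cpartial :: "'n \<Rightarrow> (complex ^ 'n \<Rightarrow> complex) \<Rightarrow> complex ^ 'n \<Rightarrow> complex" where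
  "cpartial j f z = deriv (\<lambda>w. f (\<chi> k. if k = j then w else z $ k)) (z $ j)"

text \<open>The tangent vector \<open>\<Sum>\<^sub>j X\<^sub>j \<partial>/\<partial>z\<^sub>j\<close> is represented by its coefficient vector \<open>X\<close>.\<close>
definition vec_apply :: "complex ^ 'n \<Rightarrow> (complex ^ 'n \<Rightarrow> complex) \<Rightarrow> complex ^ 'n \<Rightarrow> complex" where
  "vec_apply X f z = (\<Sum>j\<in>UNIV. X $ j * cpartial j f z)"

definition push_forward ::
    "(complex ^ 'n \<Rightarrow> complex ^ 'm) \<Rightarrow> complex ^ 'n \<Rightarrow> complex ^ 'n \<Rightarrow> complex ^ 'm" where
  "push_forward F z X = (\<chi> k. vec_apply X (\<lambda>w. F w $ k) z)"

text \<open>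
  Elements of \<open>A\<^sup>p(\<Omega>)\<close> are represented by total functions whose values off \<open>\<Omega>\<close> are
  irrelevant. \<open>lborel\<close> on \<open>complex ^ 'n\<close> is Lebesgue measure on the underlying real
  Euclidean space of dimension \<open>2n\<close>.
\<close>
definition bergman_space :: "(complex ^ 'n) set \<Rightarrow> real \<Rightarrow> (complex ^ 'n \<Rightarrow> complex) set" where
  "bergman_space \<Omega> p =
     {f. f mholomorphic_on \<Omega> \<and> set_integrable lborel \<Omega> (\<lambda>w. cmod (f w) powr p)}"

definition Lp_norm :: "(complex ^ 'n) set \<Rightarrow> real \<Rightarrow> (complex ^ 'n \<Rightarrow> complex) \<Rightarrow> real" where
  "Lp_norm \<Omega> p f = (LINT w:\<Omega>|lborel. cmod (f w) powr p) powr (1 / p)"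

definition bergman_m :: "(complex ^ 'n) set \<Rightarrow> real \<Rightarrow> complex ^ 'n \<Rightarrow> real" where
  "bergman_m \<Omega> p z = Inf {Lp_norm \<Omega> p f | f. f \<in> bergman_space \<Omega> p \<and> f z = 1}"

definition bergman_K :: "(complex ^ 'n) set \<Rightarrow> real \<Rightarrow> complex ^ 'n \<Rightarrow> real" where
  "bergman_K \<Omega> p z = bergman_m \<Omega> p z powr (- p)"

text \<open>
  For a bounded domain, \<open>p > 0\<close> and \<open>z \<in> \<Omega>\<close>, the set below is nonempty (a normalised
  coordinate function minus its value at \<open>z\<close>) and bounded above (Cauchy estimates and the
  sub-mean-value property of \<open>\<bar>f\<bar>\<^sup>p\<close>), so the real-valued \<open>Sup\<close> is the actual supremum;
  likewise \<open>Inf\<close> above, where the constant function 1 is a competitor.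
\<close>
definition bergman_B ::
    "(complex ^ 'n) set \<Rightarrow> real \<Rightarrow> complex ^ 'n \<Rightarrow> complex ^ 'n \<Rightarrow> real" where
  "bergman_B \<Omega> p z X = bergman_K \<Omega> p z powr (- 1 / p) *
     Sup {cmod (vec_apply X f z) | f. f \<in> bergman_space \<Omega> p \<and> f z = 0 \<and> Lp_norm \<Omega> p f = 1}"

end

theory Submission
  imports Defs "HOL-Complex_Analysis.Cauchy_Integral_Formula"
begin

text \<open>
  Write \<open>J\<close> for the complex Jacobian determinant of \<open>F\<close>. A biholomorphic change of variables
  multiplies Lebesgue measure by \<open>\<bar>J\<bar>\<^sup>2\<close>. Hence, if \<open>g\<close> is a holomorphic function on \<open>\<Omega>1\<close> with
  \<open>\<bar>g\<bar>\<^sup>p = \<bar>J\<bar>\<^sup>2\<close>, the map \<open>f \<mapsto> (f \<circ> F) g\<close> is a norm-preserving bijection from \<open>A\<^sup>p(\<Omega>2)\<close> onto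
  \<open>A\<^sup>p(\<Omega>1)\<close>. The function \<open>g\<close> is a branch of \<open>J\<close> to the power \<open>2/p\<close>: on a simply connected domain it
  is \<open>exp ((2/p) L)\<close> for a continuous, hence holomorphic, logarithm \<open>L\<close> of the nowhere vanishing
  function \<open>J\<close>, and for integer \<open>2/p\<close> it is an ordinary power.

  Under this bijection the values at \<open>z\<close> are those at \<open>F z\<close> multiplied by \<open>g z\<close>, so the minimal norm
  \<open>m\<^sub>p\<close> is divided by \<open>\<bar>g z\<bar>\<close>. For functions vanishing at \<open>F z\<close> the product and chain rules show that
  the directional derivatives are multiplied by \<open>g z\<close> too, so the supremum in the metric is multiplied
  by \<open>\<bar>g z\<bar>\<close>. The two factors cancel.

  Four ingredients need work. First, a complex matrix \<open>A\<close> acts as a real linear map with determinant of modulus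
  \<open>\<bar>det A\<bar>\<^sup>2\<close>; the
  argument identifies two multiplicative functions of matrices by elimination
  (\<open>multiplicative_on_matrices_unique\<close>). Second, the change of variables formula is transported from
  real coordinate spaces along an isometry (\<open>complex_change_of_variables\<close>). Third, \<open>J\<close> is holomorphic because
  derivatives of holomorphic functions are, which follows by differentiating Cauchy's formula under
  the integral (\<open>mholomorphic_on_vec_apply\<close>). Fourth, the supremum scales as expected only because the
  set of competing values is nonempty and bounded; boundedness is a local sup-norm estimate by the
  \<open>L\<^sup>p\<close> norm for every \<open>p > 0\<close> (\<open>Lp_ball_locally_bounded\<close>).
\<close>

section \<open>Holomorphic functions of several variables\<close>

text \<open>
  A complex linear derivative restricts to each coordinate line as multiplication by a coefficient.
  This ties the one-variable derivatives in the definition of the metric to the total derivative.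
\<close>

lemma has_derivative_complex_linear_form:
  fixes f :: "complex ^ 'n \<Rightarrow> complex"
  assumes "(f has_derivative (\<lambda>h. \<Sum>j\<in>UNIV. a $ j * h $ j)) (at z)"
  shows "cpartial j f z = a $ j"
proof -
  let ?s = "\<lambda>w. \<chi> k. if k = j then w else z $ k"
  have s: "(?s has_derivative (\<lambda>h. axis j h)) (at (z $ j))"
    unfolding has_derivative_componentwise_within[of ?s]
  proof
    fix b :: "complex ^ 'n" assume "b \<in> Basis"
    then obtain k c where b: "b = axis k c" by (auto simp: Basis_vec_def)
    have "((\<lambda>w. (if k = j then w else z $ k)) has_derivative (\<lambda>h. if k = j then h else 0)) (at (z $ j))"
      by (cases "k = j") auto
    then show "((\<lambda>x. ?s x \<bullet> b) has_derivative (\<lambda>x. axis j x \<bullet> b)) (at (z $ j))"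
      unfolding b inner_axis
      by (auto simp: axis_def eq_commute[of k j] cong: if_cong intro!: derivative_eq_intros)
  qed
  have "?s (z $ j) = z" by (simp add: vec_eq_iff)
  then have "((f \<circ> ?s) has_derivative ((\<lambda>h. \<Sum>j\<in>UNIV. a $ j * h $ j) \<circ> (\<lambda>h. axis j h))) (at (z $ j))"
    by (intro diff_chain_at[OF s]) (simp add: assms)
  moreover have "((\<lambda>h. \<Sum>j\<in>UNIV. a $ j * h $ j) \<circ> (\<lambda>h. axis j h)) = (*) (a $ j)"
    by (auto simp: axis_def fun_eq_iff if_distrib cong: if_cong)
  ultimately have "((\<lambda>w. f (?s w)) has_field_derivative (a $ j)) (at (z $ j))"
    unfolding has_field_derivative_def by (simp add: o_def)
  then show ?thesis
    unfolding cpartial_def by (rule DERIV_imp_deriv)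
qed

text \<open>
  From here on the total derivative in direction \<open>h\<close> is always \<open>vec_apply h f z\<close>; the chain and
  product rules for the metric become statements about this one expression.
\<close>

lemma mholomorphic_has_derivative:
  assumes "f mholomorphic_on \<Omega>" "z \<in> \<Omega>"
  shows "(f has_derivative (\<lambda>h. vec_apply h f z)) (at z)"
proof -
  obtain a where a: "(f has_derivative (\<lambda>h. \<Sum>j\<in>UNIV. a $ j * h $ j)) (at z)"
    using assms unfolding mholomorphic_on_def by blast
  have "(\<lambda>h. vec_apply h f z) = (\<lambda>h. \<Sum>j\<in>UNIV. a $ j * h $ j)"
    unfolding vec_apply_def has_derivative_complex_linear_form[OF a] by (simp add: mult.commute)
  then show ?thesis using a by simp
qed

lemma complex_linear_expansion:
  fixes D :: "complex ^ 'n \<Rightarrow> complex"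
  assumes "linear D" "\<And>c h. D (c *s h) = c * D h"
  shows "D h = (\<Sum>j\<in>UNIV. D (axis j 1) * h $ j)"
proof -
  have "D h = D (\<Sum>j\<in>UNIV. h $ j *s axis j 1)"
    by (simp only: basis_expansion)
  also have "\<dots> = (\<Sum>j\<in>UNIV. D (h $ j *s axis j 1))"
    by (rule linear_sum[OF assms(1)])
  finally show ?thesis by (simp add: assms(2) mult.commute)
qed

text \<open>
  Complex homogeneity of a real derivative is enough for holomorphy, and it is usually easier to
  read off than the coefficients of the linear form.
\<close>

lemma mholomorphic_onI:
  assumes "\<And>z. z \<in> \<Omega> \<Longrightarrow> (f has_derivative D z) (at z)"
    and "\<And>z c h. z \<in> \<Omega> \<Longrightarrow> D z (c *s h) = c * D z h"
  shows "f mholomorphic_on \<Omega>"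
  unfolding mholomorphic_on_def
proof
  fix z assume z: "z \<in> \<Omega>"
  have "D z = (\<lambda>h. \<Sum>j\<in>UNIV. (\<chi> j. D z (axis j 1)) $ j * h $ j)"
    using complex_linear_expansion[of "D z"] assms z by (auto intro: has_derivative_linear)
  then show "\<exists>a. (f has_derivative (\<lambda>h. \<Sum>j\<in>UNIV. a $ j * h $ j)) (at z)"
    using assms(1)[OF z] by metis
qed

lemma vec_apply_scale: "vec_apply (c *s X) f z = c * vec_apply X f z"
  by (simp add: vec_apply_def sum_distrib_left mult.assoc)

lemma mholomorphic_on_imp_continuous_on:
  assumes "f mholomorphic_on \<Omega>" shows "continuous_on \<Omega> f"
  using mholomorphic_has_derivative[OF assms]
  by (meson continuous_at_imp_continuous_on has_derivative_continuous)

lemma vec_apply_unique: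
  assumes "(f has_derivative D) (at z)" "f mholomorphic_on \<Omega>" "z \<in> \<Omega>"
  shows "vec_apply X f z = D X"
  using has_derivative_unique[OF mholomorphic_has_derivative[OF assms(2,3)] assms(1)] by metis

lemma mholomorphic_on_const [intro]: "(\<lambda>z. c) mholomorphic_on \<Omega>"
  by (rule mholomorphic_onI[where D = "\<lambda>_ _. 0"]) auto

lemma mholomorphic_on_component [intro]: "(\<lambda>z. z $ j) mholomorphic_on \<Omega>"
  by (rule mholomorphic_onI[where D = "\<lambda>_ h. h $ j"])
     (auto intro!: bounded_linear_imp_has_derivative bounded_linear_vec_nth)

lemma mholomorphic_on_add [intro]:
  assumes "f mholomorphic_on \<Omega>" "g mholomorphic_on \<Omega>"
  shows "(\<lambda>z. f z + g z) mholomorphic_on \<Omega>"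
  by (rule mholomorphic_onI, rule has_derivative_add[OF mholomorphic_has_derivative
        mholomorphic_has_derivative, OF assms(1) _ assms(2)])
     (auto simp: vec_apply_scale algebra_simps)

lemma mholomorphic_on_mult [intro]:
  assumes "f mholomorphic_on \<Omega>" "g mholomorphic_on \<Omega>"
  shows "(\<lambda>z. f z * g z) mholomorphic_on \<Omega>"
  by (rule mholomorphic_onI, rule has_derivative_mult[OF mholomorphic_has_derivative
        mholomorphic_has_derivative, OF assms(1) _ assms(2)])
     (auto simp: vec_apply_scale algebra_simps)

lemma mholomorphic_on_sum [intro]:
  assumes "\<And>i. i \<in> I \<Longrightarrow> f i mholomorphic_on \<Omega>"
  shows "(\<lambda>z. \<Sum>i\<in>I. f i z) mholomorphic_on \<Omega>"
  using assms by (induction I rule: infinite_finite_induct) auto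

lemma mholomorphic_on_prod [intro]:
  assumes "\<And>i. i \<in> I \<Longrightarrow> f i mholomorphic_on \<Omega>"
  shows "(\<lambda>z. \<Prod>i\<in>I. f i z) mholomorphic_on \<Omega>"
  using assms by (induction I rule: infinite_finite_induct) auto

lemma mholomorphic_on_power [intro]:
  assumes "f mholomorphic_on \<Omega>" shows "(\<lambda>z. f z ^ m) mholomorphic_on \<Omega>"
  using assms by (induction m) auto

lemma mholomorphic_on_compose_field:
  assumes "f mholomorphic_on \<Omega>" "\<And>z. z \<in> \<Omega> \<Longrightarrow> (\<phi> has_field_derivative \<phi>' z) (at (f z))"
  shows "(\<lambda>z. \<phi> (f z)) mholomorphic_on \<Omega>"
proof (rule mholomorphic_onI)
  fix z assume z: "z \<in> \<Omega>"
  show "((\<lambda>z. \<phi> (f z)) has_derivative (\<lambda>h. \<phi>' z * vec_apply h f z)) (at z)"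
    using diff_chain_at[OF mholomorphic_has_derivative[OF assms(1) z], of \<phi> "(*) (\<phi>' z)"] assms(2)[OF z]
    by (simp add: has_field_derivative_def o_def)
qed (simp add: vec_apply_scale)

lemma mholomorphic_on_inverse [intro]:
  assumes "f mholomorphic_on \<Omega>" "\<And>z. z \<in> \<Omega> \<Longrightarrow> f z \<noteq> 0"
  shows "(\<lambda>z. inverse (f z)) mholomorphic_on \<Omega>"
  by (rule mholomorphic_on_compose_field[OF assms(1)]) (auto intro!: derivative_eq_intros assms(2))

lemma mholomorphic_on_cong:
  assumes "open \<Omega>" "\<And>z. z \<in> \<Omega> \<Longrightarrow> f z = g z" "f mholomorphic_on \<Omega>"
  shows "g mholomorphic_on \<Omega>"
  by (rule mholomorphic_onI, rule has_derivative_transform_within_open[OF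
        mholomorphic_has_derivative[OF assms(3)] assms(1)])
     (auto simp: assms(2) vec_apply_scale)

lemma mholomorphic_on_subset:
  "f mholomorphic_on \<Omega> \<Longrightarrow> \<Omega>' \<subseteq> \<Omega> \<Longrightarrow> f mholomorphic_on \<Omega>'"
  unfolding mholomorphic_on_def by blast

lemma holomorphic_map_has_derivative:
  fixes F :: "complex ^ 'n \<Rightarrow> complex ^ 'm"
  assumes "holomorphic_map_on F \<Omega>" "z \<in> \<Omega>"
  shows "(F has_derivative push_forward F z) (at z)"
  unfolding has_derivative_componentwise_within[of F]
proof
  fix b :: "complex ^ 'm" assume "b \<in> Basis"
  then obtain k c where b: "b = axis k c" by (auto simp: Basis_vec_def)
  have "((\<lambda>z. F z $ k) has_derivative (\<lambda>h. vec_apply h (\<lambda>w. F w $ k) z)) (at z)"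
    using assms mholomorphic_has_derivative unfolding holomorphic_map_on_def by blast
  then show "((\<lambda>x. F x \<bullet> b) has_derivative (\<lambda>x. push_forward F z x \<bullet> b)) (at z)"
    unfolding b inner_axis push_forward_def by (simp add: has_derivative_inner_left)
qed

lemma push_forward_scale: "push_forward F z (c *s X) = c *s push_forward F z X"
  by (simp add: push_forward_def vec_apply_scale vec_eq_iff)

lemma mholomorphic_on_compose_map:
  fixes F :: "complex ^ 'n \<Rightarrow> complex ^ 'm"
  assumes "f mholomorphic_on \<Omega>'" "holomorphic_map_on F \<Omega>" "F ` \<Omega> \<subseteq> \<Omega>'"
  shows "(\<lambda>z. f (F z)) mholomorphic_on \<Omega>"
    and "z \<in> \<Omega> \<Longrightarrow> vec_apply X (\<lambda>z. f (F z)) z = vec_apply (push_forward F z X) f (F z)"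
proof -
  have der: "((\<lambda>z. f (F z)) has_derivative (\<lambda>h. vec_apply (push_forward F z h) f (F z))) (at z)"
    if "z \<in> \<Omega>" for z
    using diff_chain_at[OF holomorphic_map_has_derivative[OF assms(2) that]
      mholomorphic_has_derivative[OF assms(1)]] assms(3) that
    by (auto simp: o_def)
  show *: "(\<lambda>z. f (F z)) mholomorphic_on \<Omega>"
    by (rule mholomorphic_onI[OF der]) (auto simp: push_forward_scale vec_apply_scale)
  show "z \<in> \<Omega> \<Longrightarrow> vec_apply X (\<lambda>z. f (F z)) z = vec_apply (push_forward F z X) f (F z)"
    using vec_apply_unique[OF der *] by blast
qed

section \<open>The real determinant of a complex matrix\<close>

text \<open>
  The identity matrix with the off-diagonal part of column \<open>k\<close> taken from \<open>v\<close>. Multiplication from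
  the left clears a whole column at once; multiplication from the right adds other columns to column \<open>k\<close>.
\<close>

definition column_shear :: "'n \<Rightarrow> complex ^ 'n \<Rightarrow> complex ^ 'n ^ 'n" where
  "column_shear k v = (\<chi> i j. if i = j then 1 else if j = k then v $ i else 0)"

definition diag_matrix :: "('n \<Rightarrow> complex) \<Rightarrow> complex ^ 'n ^ 'n" where
  "diag_matrix d = (\<chi> i j. if i = j then d i else 0)"

lemma diag_matrix_mult:
  "(A ** diag_matrix d) $ i $ j = A $ i $ j * d j"
  "(diag_matrix d ** A) $ i $ j = d i * A $ i $ j"
  by (simp_all add: matrix_matrix_mult_def diag_matrix_def if_distrib if_distribR cong: if_cong)

lemma mult_column_shear:
  "(A ** column_shear k v) $ i $ j =
     (if j = k then A $ i $ k + (\<Sum>l\<in>UNIV - {k}. A $ i $ l * v $ l) else A $ i $ j)"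
proof (cases "j = k")
  case True
  have "(A ** column_shear k v) $ i $ k = (\<Sum>l\<in>UNIV. A $ i $ l * (if l = k then 1 else v $ l))"
    unfolding matrix_matrix_mult_def column_shear_def by (auto intro!: sum.cong)
  also have "\<dots> = A $ i $ k + (\<Sum>l\<in>UNIV - {k}. A $ i $ l * v $ l)"
    by (subst sum.remove[of _ k]) auto
  finally show ?thesis using True by simp
next
  case False
  then have "(A ** column_shear k v) $ i $ j = (\<Sum>l\<in>UNIV. if l = j then A $ i $ j else 0)"
    unfolding matrix_matrix_mult_def column_shear_def vec_lambda_beta by (intro sum.cong) auto
  with False show ?thesis by simp
qed

lemma column_shear_mult:
  "(column_shear k v ** A) $ i $ j =
     (if i = k then A $ k $ j else A $ i $ j + v $ i * A $ k $ j)"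
proof -
  have "(column_shear k v ** A) $ i $ j =
     (\<Sum>l\<in>UNIV. (if l = i then A $ i $ j else 0) + (if l = k then (if i = k then 0 else v $ i * A $ k $ j) else 0))"
    unfolding matrix_matrix_mult_def column_shear_def vec_lambda_beta by (rule sum.cong) auto
  also have "\<dots> = A $ i $ j + (if i = k then 0 else v $ i * A $ k $ j)"
    by (simp add: sum.distrib)
  finally show ?thesis by simp
qed

text \<open>
  Conjugation by a diagonal matrix doubles a shear, and squaring doubles it as well. A multiplicative
  function therefore takes the same value on a shear and on its square.
\<close>

lemma column_shear_conj:
  "column_shear k (2 *s v) ** diag_matrix (\<lambda>i. if i = k then 1/2 else 1) =
   diag_matrix (\<lambda>i. if i = k then 1/2 else 1) ** column_shear k v"
  by (auto simp: vec_eq_iff diag_matrix_mult column_shear_def)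

lemma column_shear_square: "column_shear k v ** column_shear k v = column_shear k (2 *s v)"
  by (simp add: vec_eq_iff column_shear_mult) (auto simp: column_shear_def)

lemma column_shear_inverse: "column_shear k (- v) ** column_shear k v = mat 1"
  by (simp add: vec_eq_iff column_shear_mult) (auto simp: column_shear_def mat_def)

text \<open>
  The value \<open>x\<close> at a shear satisfies \<open>x\<^sup>2 = x\<close> because the square of the shear is conjugate to it, and
  it is nonzero because the shear is invertible.
\<close>

lemma multiplicative_column_shear:
  fixes \<delta> :: "complex ^ 'n ^ 'n \<Rightarrow> real"
  assumes mult: "\<And>A B. \<delta> (A ** B) = \<delta> A * \<delta> B"
    and diag: "\<And>d. \<delta> (diag_matrix d) = (\<Prod>i\<in>UNIV. cmod (d i) ^ 2)"
  shows "\<delta> (column_shear k v) = 1"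
proof -
  let ?D = "diag_matrix (\<lambda>i. if i = k then 1/2 else 1)"
  have one: "\<delta> (mat 1) = 1"
    using diag[of "\<lambda>_. 1"] by (simp add: diag_matrix_def mat_def)
  have D: "\<delta> ?D \<noteq> 0" by (auto simp: diag)
  have "\<delta> (column_shear k (2 *s v)) * \<delta> ?D = \<delta> ?D * \<delta> (column_shear k v)"
    by (metis mult column_shear_conj)
  with D have "\<delta> (column_shear k (2 *s v)) = \<delta> (column_shear k v)" by simp
  then have "\<delta> (column_shear k v) * \<delta> (column_shear k v) = \<delta> (column_shear k v)"
    by (metis mult column_shear_square)
  moreover have "\<delta> (column_shear k (- v)) * \<delta> (column_shear k v) = 1"
    by (metis mult column_shear_inverse one)
  ultimately show ?thesis by force
qed

text \<open>
  Gaussian elimination: shears reduce every matrix either to a diagonal matrix or to one with a zero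
  row, and both functions take the value 1 on shears. It serves to compare the real determinant of a
  complex matrix with \<open>\<bar>det A\<bar>\<^sup>2\<close>.
\<close>

lemma multiplicative_on_matrices_unique:
  fixes \<delta> \<delta>' :: "complex ^ 'n ^ 'n \<Rightarrow> real"
  assumes mult: "\<And>A B. \<delta> (A ** B) = \<delta> A * \<delta> B" "\<And>A B. \<delta>' (A ** B) = \<delta>' A * \<delta>' B"
    and diag: "\<And>d. \<delta> (diag_matrix d) = (\<Prod>i\<in>UNIV. cmod (d i) ^ 2)"
      "\<And>d. \<delta>' (diag_matrix d) = (\<Prod>i\<in>UNIV. cmod (d i) ^ 2)"
    and zero_row: "\<And>A i. row i A = 0 \<Longrightarrow> \<delta> A = 0" "\<And>A i. row i A = 0 \<Longrightarrow> \<delta>' A = 0"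
  shows "\<delta> A = \<delta>' A"
proof -
  note shear = multiplicative_column_shear[of \<delta>, OF mult(1) diag(1)]
    multiplicative_column_shear[of \<delta>', OF mult(2) diag(2)]
  have "\<delta> A = \<delta>' A" if "\<And>i j. j \<notin> K \<Longrightarrow> i \<noteq> j \<Longrightarrow> A $ i $ j = 0" for A K
    using finite[of K] that
  \<comment> \<open>\<open>K\<close> contains the columns that may still have entries off the diagonal.\<close>
  proof (induction K arbitrary: A rule: finite_induct)
    case empty
    then have "A = diag_matrix (\<lambda>i. A $ i $ i)"
      by (auto simp: diag_matrix_def vec_eq_iff)
    then show ?case by (metis diag)
  next
    case (insert k K)
    have pivot: "\<delta> B = \<delta>' B" if nz: "B $ k $ k \<noteq> 0"
      and B: "\<And>i j. j \<notin> insert k K \<Longrightarrow> i \<noteq> j \<Longrightarrow> B $ i $ j = 0" for B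
    proof -
      \<comment> \<open>With a nonzero pivot, one shear from the left clears column \<open>k\<close>. The columns outside \<open>K\<close> have a zero in row \<open>k\<close>, so they do not change.\<close>
      define v where "v = (\<chi> i. - (B $ i $ k / B $ k $ k))"
      have "\<delta> (column_shear k v ** B) = \<delta>' (column_shear k v ** B)"
      proof (rule insert.IH)
        fix i j assume "j \<notin> K" "i \<noteq> j"
        then show "(column_shear k v ** B) $ i $ j = 0"
          using nz B[of j i] B[of j k] by (cases "j = k") (auto simp: column_shear_mult v_def)
      qed
      then show ?thesis by (simp add: mult shear)
    qed
    show ?case
    proof (cases "row k A = 0")
      case True
      then show ?thesis by (simp add: zero_row)
    next
      case row: False
      show ?thesis
      proof (cases "A $ k $ k = 0")
        case False
        then show ?thesis using pivot insert.prems by blast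
      next
        case True
        from row obtain l where l: "A $ k $ l \<noteq> 0"
          by (auto simp: row_def vec_eq_iff)
        with True have "l \<noteq> k" by auto
        \<comment> \<open>The pivot vanishes, so column \<open>l\<close>, which has a nonzero entry in row \<open>k\<close>, is first added to column \<open>k\<close>.\<close>
        have "\<delta> (A ** column_shear k (axis l 1)) = \<delta>' (A ** column_shear k (axis l 1))"
        proof (rule pivot)
          have "(\<Sum>j\<in>UNIV - {k}. A $ k $ j * axis l 1 $ j) = A $ k $ l"
            using \<open>l \<noteq> k\<close> by (simp add: axis_def if_distrib cong: if_cong)
          then show "(A ** column_shear k (axis l 1)) $ k $ k \<noteq> 0"
            using l True by (simp add: mult_column_shear)
        qed (use insert.prems in \<open>auto simp: mult_column_shear\<close>)
        then show ?thesis by (simp add: mult shear)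
      qed
    qed
  qed
  from this[of UNIV] show ?thesis by simp
qed

text \<open>
  A bijection between the standard bases extends to a linear isometry, and it maps boxes to boxes
  with the same side lengths, so it preserves Lebesgue measure.
\<close>

lemma basis_isometry:
  assumes "DIM('a::euclidean_space) = DIM('b::euclidean_space)"
  obtains \<phi> :: "'a::euclidean_space \<Rightarrow> 'b::euclidean_space" and \<psi> :: "'b \<Rightarrow> 'a"
  where "linear \<phi>" "linear \<psi>" "\<And>x. \<psi> (\<phi> x) = x" "\<And>y. \<phi> (\<psi> y) = y"
    "\<And>x y. \<phi> x \<bullet> \<phi> y = x \<bullet> y" "bij_betw \<phi> Basis Basis" "distr lborel borel \<phi> = lborel"
proof -
  obtain \<beta> :: "'a \<Rightarrow> 'b" where \<beta>: "bij_betw \<beta> Basis Basis"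
    using finite_same_card_bij[OF finite_Basis finite_Basis assms] by blast
  define \<phi> :: "'a \<Rightarrow> 'b" where "\<phi> x = (\<Sum>a\<in>Basis. (x \<bullet> a) *\<^sub>R \<beta> a)" for x
  define \<psi> :: "'b \<Rightarrow> 'a" where "\<psi> y = (\<Sum>a\<in>Basis. (y \<bullet> \<beta> a) *\<^sub>R a)" for y
  have lin: "linear \<phi>" "linear \<psi>"
    unfolding \<phi>_def \<psi>_def
    by (auto intro!: linearI simp: inner_left_distrib scaleR_left_distrib sum.distrib scaleR_sum_right)
  have \<phi>\<beta>: "\<phi> a = \<beta> a" if "a \<in> Basis" for a
  proof -
    have "\<phi> a = (\<Sum>a'\<in>Basis. if a' = a then \<beta> a' else 0)"
      unfolding \<phi>_def using that by (intro sum.cong) (auto simp: inner_Basis)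
    then show ?thesis using that by simp
  qed
  have \<beta>\<beta>: "\<beta> a \<bullet> \<beta> a' = a \<bullet> a'" if "a \<in> Basis" "a' \<in> Basis" for a a'
  proof -
    have "\<beta> a \<in> Basis" "\<beta> a' \<in> Basis" "\<beta> a = \<beta> a' \<longleftrightarrow> a = a'"
      using \<beta> that by (auto simp: bij_betw_def inj_on_def)
    with that show ?thesis by (simp add: inner_Basis)
  qed
  have inner: "\<phi> x \<bullet> \<phi> y = x \<bullet> y" for x y
  proof -
    have "\<phi> x \<bullet> \<phi> y = (\<Sum>a\<in>Basis. \<Sum>a'\<in>Basis. (x \<bullet> a) * ((y \<bullet> a') * (\<beta> a \<bullet> \<beta> a')))"
      by (simp add: \<phi>_def inner_sum_left inner_sum_right sum_distrib_left mult_ac) (rule sum.swap)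
    also have "\<dots> = (\<Sum>a\<in>Basis. \<Sum>a'\<in>Basis. if a' = a then (x \<bullet> a) * (y \<bullet> a') else 0)"
      by (intro sum.cong refl) (auto simp: \<beta>\<beta> inner_Basis)
    also have "\<dots> = x \<bullet> y" by (simp add: euclidean_inner[of x y])
    finally show ?thesis .
  qed
  have \<phi>\<psi>: "\<phi> (\<psi> y) = y" for y
  proof -
    have "\<phi> (\<psi> y) = (\<Sum>a\<in>Basis. (y \<bullet> \<beta> a) *\<^sub>R \<beta> a)"
      unfolding \<psi>_def linear_sum[OF lin(1)]
      by (intro sum.cong refl) (simp add: linear_scale[OF lin(1)] \<phi>\<beta>)
    also have "\<dots> = (\<Sum>b\<in>Basis. (y \<bullet> b) *\<^sub>R b)"
      by (rule sum.reindex_bij_betw[OF \<beta>])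
    finally show ?thesis by (simp add: euclidean_representation)
  qed
  have "inj \<phi>"
    by (rule injI) (metis inner inner_diff_left inner_diff_right linear_diff[OF lin(1)] vector_eq)
  then have \<psi>\<phi>: "\<psi> (\<phi> x) = x" for x using \<phi>\<psi> by (metis injD)
  have bij: "bij_betw \<phi> Basis Basis" using \<beta> by (simp cong: bij_betw_cong add: \<phi>\<beta>)
  have [measurable]: "\<phi> \<in> borel_measurable borel"
    using lin by (intro borel_measurable_continuous_onI) (simp add: linear_continuous_on linear_conv_bounded_linear)
  have "lborel = distr lborel borel \<phi>"
  proof (rule lborel_eqI)
    fix l u :: 'b assume le: "\<And>b. b \<in> Basis \<Longrightarrow> l \<bullet> b \<le> u \<bullet> b"
    have \<psi>b: "\<psi> y \<bullet> a = y \<bullet> \<phi> a" for y a by (metis inner \<phi>\<psi>)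
    have pre: "\<phi> -` box l u = box (\<psi> l) (\<psi> u)"
    proof -
      have "\<phi> x \<in> box l u \<longleftrightarrow> (\<forall>b\<in>\<phi> ` Basis. l \<bullet> b < \<phi> x \<bullet> b \<and> \<phi> x \<bullet> b < u \<bullet> b)" for x
        using bij by (simp add: mem_box bij_betw_def)
      then show ?thesis by (auto simp: mem_box \<psi>b inner)
    qed
    have "emeasure (distr lborel borel \<phi>) (box l u) = emeasure lborel (\<phi> -` box l u)"
      by (simp add: emeasure_distr)
    also have "\<dots> = (\<Prod>a\<in>Basis. (\<psi> u - \<psi> l) \<bullet> a)"
      unfolding pre using le bij by (subst emeasure_lborel_box) (auto simp: \<psi>b bij_betw_def)
    also have "(\<Prod>a\<in>Basis. (\<psi> u - \<psi> l) \<bullet> a) = (\<Prod>a\<in>Basis. (u - l) \<bullet> \<phi> a)"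
      by (simp add: inner_diff_left \<psi>b)
    also have "\<dots> = (\<Prod>b\<in>Basis. (u - l) \<bullet> b)"
      by (rule prod.reindex_bij_betw[OF bij])
    finally show "emeasure (distr lborel borel \<phi>) (box l u) = (\<Prod>b\<in>Basis. (u - l) \<bullet> b)" .
  qed simp
  then show thesis using that[OF lin \<psi>\<phi> \<phi>\<psi> inner bij] by simp
qed

lemma linear_matrix_vector_mult_complex: "linear ((*v) (A :: complex ^ 'n ^ 'm))"
  by (rule linearI)
     (simp_all add: vec_eq_iff matrix_vector_mult_def scaleR_sum_right distrib_left sum.distrib)

lemma diag_matrix_vector_mult: "(diag_matrix d *v x) $ i = d i * x $ i"
proof -
  have "(diag_matrix d *v x) $ i = (\<Sum>j\<in>UNIV. if j = i then d i * x $ i else 0)"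
    unfolding matrix_vector_mult_def diag_matrix_def vec_lambda_beta by (rule sum.cong) auto
  then show ?thesis by simp
qed

lemma det_diag_matrix: "det (diag_matrix d) = (\<Prod>i\<in>UNIV. d i)"
  by (subst det_diagonal) (auto simp: diag_matrix_def)

text \<open>
  By the uniqueness lemma only diagonal matrices need to be computed. A diagonal matrix factors into a
  unitary one, which is orthogonal over the reals, and one with entries \<open>\<bar>d\<^sub>i\<bar>\<close>, which is
  diagonal in the real basis with each entry occurring twice.
\<close>

lemma real_det_eq_cmod_det_square:
  fixes A :: "complex ^ 'n ^ 'n"
    and \<phi> :: "complex ^ 'n \<Rightarrow> real ^ 'r::finite" and \<psi> :: "real ^ 'r \<Rightarrow> complex ^ 'n"
  assumes lin: "linear \<phi>" "linear \<psi>" and inv: "\<And>x. \<psi> (\<phi> x) = x" "\<And>y. \<phi> (\<psi> y) = y"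
    and inner: "\<And>x y. \<phi> x \<bullet> \<phi> y = x \<bullet> y" and bij: "bij_betw \<phi> Basis Basis"
  shows "\<bar>det (matrix (\<lambda>y. \<phi> (A *v \<psi> y)))\<bar> = cmod (det A) ^ 2"
proof -
  have norm_\<phi>: "norm (\<phi> x) = norm x" for x
    by (simp add: norm_eq_sqrt_inner inner)
  have norm_\<psi>: "norm (\<psi> y) = norm y" for y
    by (metis norm_\<phi> inv(2))
  define T where "T A = (\<lambda>y. \<phi> (A *v \<psi> y))" for A :: "complex ^ 'n ^ 'n"
  have linT: "linear (T A)" for A
    unfolding T_def using linear_compose[OF linear_compose[OF lin(2) linear_matrix_vector_mult_complex] lin(1)]
    by (simp add: o_def)
  define \<delta> where "\<delta> A = \<bar>det (matrix (T A))\<bar>" for A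
  have comp: "T (A ** B) = T A \<circ> T B" for A B
    by (simp add: T_def fun_eq_iff inv matrix_vector_mul_assoc)
  have mult: "\<delta> (A ** B) = \<delta> A * \<delta> B" for A B
    unfolding \<delta>_def comp matrix_compose[OF linT linT] by (simp add: det_mul abs_mult)
  have diag: "\<delta> (diag_matrix d) = (\<Prod>i\<in>UNIV. cmod (d i) ^ 2)" for d :: "'n \<Rightarrow> complex"
  proof -
    have split: "diag_matrix d = diag_matrix (\<lambda>i. of_real (cmod (d i))) ** diag_matrix (\<lambda>i. if d i = 0 then 1 else sgn (d i))"
      by (auto simp: vec_eq_iff diag_matrix_mult) (auto simp: diag_matrix_def sgn_div_norm scaleR_conv_of_real)
    have "\<delta> (diag_matrix (\<lambda>i. if d i = 0 then 1 else sgn (d i))) = 1"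
    proof -
      have "norm (diag_matrix (\<lambda>i. if d i = 0 then 1 else sgn (d i)) *v x) = norm x" for x
        by (auto simp: norm_vec_def diag_matrix_vector_mult norm_mult norm_sgn intro!: L2_set_cong)
      then have "orthogonal_transformation (T (diag_matrix (\<lambda>i. if d i = 0 then 1 else sgn (d i))))"
        unfolding orthogonal_transformation using linT norm_\<phi> norm_\<psi> by (simp add: T_def)
      then show ?thesis unfolding \<delta>_def by simp
    qed
    moreover have "\<delta> (diag_matrix (\<lambda>i. of_real (cmod (d i)))) = (\<Prod>i\<in>UNIV. cmod (d i) ^ 2)"
    proof -
      let ?D = "diag_matrix (\<lambda>i. of_real (cmod (d i)))"
      \<comment> \<open>A real basis vector is supported in one coordinate, so \<open>c\<close> is the eigenvalue belonging to it.\<close>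
      define c :: "complex ^ 'n \<Rightarrow> real" where
        "c b = (\<Prod>i\<in>UNIV. if b $ i \<noteq> 0 then cmod (d i) else 1)" for b
      have c_axis: "c (axis k e) = cmod (d k)" if "e \<noteq> 0" for k e
      proof -
        have "c (axis k e) = (\<Prod>i\<in>UNIV. if i = k then cmod (d i) else 1)"
          unfolding c_def using that by (intro prod.cong) (auto simp: axis_def)
        then show ?thesis by simp
      qed
      have D: "?D *v b = c b *\<^sub>R b" if "b \<in> Basis" for b
      proof -
        from \<open>b \<in> Basis\<close> obtain k e where b: "b = axis k e" by (auto simp: Basis_vec_def)
        then have "e \<noteq> 0" using that nonzero_Basis by auto
        then show ?thesis
          unfolding b c_axis[OF \<open>e \<noteq> 0\<close>]
          by (simp add: vec_eq_iff diag_matrix_vector_mult axis_def) (simp add: scaleR_conv_of_real)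
      qed
      have TD: "T ?D b = c (\<psi> b) *\<^sub>R b" if "b \<in> Basis" for b
      proof -
        from \<open>b \<in> Basis\<close> obtain a where "a \<in> Basis" "b = \<phi> a" using bij by (auto simp: bij_betw_def)
        then show ?thesis by (simp add: T_def inv D linear_scale[OF lin(1)])
      qed
      have M: "matrix (T ?D) $ i $ j = (if i = j then c (\<psi> (axis j 1)) else 0)" for i j
        unfolding matrix_def by (simp add: TD axis_in_Basis_iff) (simp add: axis_def)
      have "det (matrix (T ?D)) = (\<Prod>i\<in>UNIV. c (\<psi> (axis i 1)))"
        by (subst det_diagonal) (auto simp: M)
      also have "\<dots> = (\<Prod>b\<in>(Basis :: (real ^ 'r) set). c (\<psi> b))"
      proof -
        have "bij_betw (\<lambda>i. axis i 1) UNIV (Basis :: (real ^ 'r) set)"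
          by (auto simp: bij_betw_def Basis_vec_def inj_on_def axis_eq_axis)
        from prod.reindex_bij_betw[OF this, of "\<lambda>b. c (\<psi> b)"] show ?thesis by simp
      qed
      also have "\<dots> = (\<Prod>a\<in>Basis. c a)"
        using prod.reindex_bij_betw[OF bij, of "\<lambda>b. c (\<psi> b)"] by (simp add: inv)
      also have "\<dots> = (\<Prod>(k, e)\<in>UNIV \<times> {1, \<i>}. c (axis k e))"
      proof -
        have "bij_betw (\<lambda>(k, e). axis k e) (UNIV \<times> {1, \<i>}) (Basis :: (complex ^ 'n) set)"
          by (auto simp: bij_betw_def Basis_vec_def Basis_complex_def inj_on_def axis_eq_axis image_iff)
        from prod.reindex_bij_betw[OF this, of c] show ?thesis by (simp add: case_prod_unfold)
      qed
      also have "\<dots> = (\<Prod>k\<in>UNIV. cmod (d k) ^ 2)"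
        by (simp add: c_axis prod.cartesian_product[symmetric] power2_eq_square)
      finally show ?thesis unfolding \<delta>_def by (simp add: prod_nonneg)
    qed
    ultimately show ?thesis unfolding split mult by simp
  qed
  have zero: "\<delta> A = 0" if "row i A = 0" for A i
  proof -
    have 0: "(A *v x) $ i = 0" for x
      using that by (simp add: matrix_vector_mult_def row_def vec_eq_iff)
    have "\<not> surj (T A)"
    proof
      assume "surj (T A)"
      then obtain y where "\<phi> (axis i 1) = T A y" by (metis surjD)
      then have "axis i 1 = A *v \<psi> y" by (metis T_def inv(1))
      with 0[of "\<psi> y"] show False by (metis axis_nth zero_neq_one)
    qed
    then show ?thesis
      unfolding \<delta>_def using det_nz_iff_inj[OF linT] linear_injective_imp_surjective[OF linT] by auto
  qed
  have "\<delta> A = cmod (det A) ^ 2"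
  proof (rule multiplicative_on_matrices_unique)
    show "cmod (det A) ^ 2 = 0" if "row i A = 0" for A :: "complex ^ 'n ^ 'n" and i
      using det_zero_row(1)[of i A] that by (simp add: row_def)
  qed (auto simp: mult diag zero det_mul norm_mult power_mult_distrib det_diag_matrix prod_norm[symmetric] prod_power_distrib)
  then show ?thesis by (simp add: \<delta>_def T_def)
qed

section \<open>Change of variables on complex coordinate space\<close>

text \<open>
  Passage between \<open>lborel\<close> on a general Euclidean space and gauge integration on another one, in the
  form in which the change of variables theorem for real coordinate spaces is stated.
\<close>

lemma set_lborel_transport:
  fixes \<phi> :: "'a::euclidean_space \<Rightarrow> 'b::euclidean_space" and k :: "'a \<Rightarrow> real"
  assumes lin: "linear \<phi>" "linear \<psi>" and inv: "\<And>x. \<psi> (\<phi> x) = x" "\<And>y. \<phi> (\<psi> y) = y"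
    and distr: "distr lborel borel \<phi> = lborel"
    and meas: "set_borel_measurable borel U k"
  shows "set_integrable lborel U k \<longleftrightarrow> (\<lambda>y. k (\<psi> y)) absolutely_integrable_on \<phi> ` U"
    and "(\<lambda>y. k (\<psi> y)) absolutely_integrable_on \<phi> ` U \<Longrightarrow>
      (LINT x:U|lborel. k x) = integral (\<phi> ` U) (\<lambda>y. k (\<psi> y))"
proof -
  have [measurable]: "\<phi> \<in> borel_measurable borel" "\<psi> \<in> borel_measurable borel"
    using lin by (auto intro!: borel_measurable_continuous_onI simp: linear_continuous_on linear_conv_bounded_linear)
  define K where "K = (\<lambda>x. indicator U x *\<^sub>R k x)"
  have [measurable]: "K \<in> borel_measurable borel"
    using meas unfolding set_borel_measurable_def K_def .
  have K\<psi>: "(\<lambda>y. indicator (\<phi> ` U) y *\<^sub>R k (\<psi> y)) = (\<lambda>y. K (\<psi> y))"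
  proof -
    have "y \<in> \<phi> ` U \<longleftrightarrow> \<psi> y \<in> U" for y by (metis inv imageE imageI)
    then show ?thesis by (simp add: K_def indicator_def)
  qed
  have K': "(\<lambda>y. K (\<psi> y)) \<in> borel_measurable lborel" by measurable
  have "integrable lborel (\<lambda>y. K (\<psi> y)) \<longleftrightarrow> integrable lborel K"
    by (subst distr[symmetric], subst integrable_distr_eq) (simp_all add: inv)
  then show iff: "set_integrable lborel U k \<longleftrightarrow> (\<lambda>y. k (\<psi> y)) absolutely_integrable_on \<phi> ` U"
    unfolding set_integrable_def K\<psi> integrable_completion[OF K'] by (simp add: K_def)
  have "(LINT y|lborel. K (\<psi> y)) = (LINT x|lborel. K x)"
    by (subst distr[symmetric], subst integral_distr) (simp_all add: inv)
  then have *: "(LINT x:U|lborel. k x) = (LINT y:\<phi> ` U|lebesgue. k (\<psi> y))"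
    unfolding set_lebesgue_integral_def K\<psi> integral_completion[OF K'] by (simp add: K_def)
  show "(LINT x:U|lborel. k x) = integral (\<phi> ` U) (\<lambda>y. k (\<psi> y))"
    if "(\<lambda>y. k (\<psi> y)) absolutely_integrable_on \<phi> ` U"
    unfolding * by (rule set_lebesgue_integral_eq_integral(2)[OF that])
qed

lemma real_valued_change_of_variables:
  fixes f :: "real ^ 'm::{finite,wellorder} \<Rightarrow> real" and g :: "real ^ 'm::_ \<Rightarrow> real ^ 'm::_"
  assumes "S \<in> sets lebesgue"
    and "\<And>x. x \<in> S \<Longrightarrow> (g has_derivative g' x) (at x within S)"
    and "inj_on g S"
  shows "(\<lambda>x. \<bar>det (matrix (g' x))\<bar> * f (g x)) absolutely_integrable_on S \<and>
           integral S (\<lambda>x. \<bar>det (matrix (g' x))\<bar> * f (g x)) = b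
     \<longleftrightarrow> f absolutely_integrable_on (g ` S) \<and> integral (g ` S) f = b"
  using has_absolute_integral_change_of_variables[OF assms, of "\<lambda>x. vec (f x) :: real ^ 1" "vec b"]
  by (simp add: absolutely_integrable_on_1_iff integral_on_1_eq)

text \<open>
  The isometry turns \<open>F\<close> into a map of a real coordinate space, and its real Jacobian determinant is
  \<open>\<bar>det A\<bar>\<^sup>2\<close> by the previous section.
\<close>

theorem complex_change_of_variables:
  fixes F :: "complex ^ 'n \<Rightarrow> complex ^ 'n" and h :: "complex ^ 'n \<Rightarrow> real"
  assumes S: "S \<in> sets borel" and inj: "inj_on F S"
    and der: "\<And>z. z \<in> S \<Longrightarrow> (F has_derivative (*v) (A z)) (at z)"
    and meas: "set_borel_measurable borel (F ` S) h"
      "set_borel_measurable borel S (\<lambda>z. cmod (det (A z)) ^ 2 * h (F z))"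
  shows "set_integrable lborel (F ` S) h \<longleftrightarrow>
      set_integrable lborel S (\<lambda>z. cmod (det (A z)) ^ 2 * h (F z))"
    and "(LINT w:F ` S|lborel. h w) = (LINT z:S|lborel. cmod (det (A z)) ^ 2 * h (F z))"
proof -
  \<comment> \<open>The type \<open>'n bit0\<close> has \<open>2 CARD('n)\<close> elements and is well-ordered for every finite \<open>'n\<close>, as the real theorem requires of its index type.\<close>
  have "DIM(complex ^ 'n) = DIM(real ^ ('n bit0))" by simp
  then obtain \<phi> :: "complex ^ 'n \<Rightarrow> real ^ ('n bit0)" and \<psi>
    where \<phi>: "linear \<phi>" "linear \<psi>" "\<And>x. \<psi> (\<phi> x) = x" "\<And>y. \<phi> (\<psi> y) = y"
    and inner: "\<And>x y. \<phi> x \<bullet> \<phi> y = x \<bullet> y" "bij_betw \<phi> Basis Basis"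
    and distr: "distr lborel borel \<phi> = lborel"
    by (rule basis_isometry) blast
  note transport = set_lborel_transport[OF \<phi> distr]
  define G where "G y = \<phi> (F (\<psi> y))" for y
  define G' where "G' y = (\<lambda>v. \<phi> (A (\<psi> y) *v \<psi> v))" for y
  have det: "\<bar>det (matrix (G' y))\<bar> = cmod (det (A (\<psi> y))) ^ 2" for y
    unfolding G'_def by (rule real_det_eq_cmod_det_square[OF \<phi> inner])
  have G_img: "G ` \<phi> ` S = \<phi> ` F ` S" by (auto simp: G_def \<phi> image_iff)
  have bl: "bounded_linear \<phi>" "bounded_linear \<psi>"
    using \<phi> by (simp_all add: linear_conv_bounded_linear)
  have "\<phi> ` S = \<psi> -` S" using \<phi>(3,4) by (auto simp: image_iff) metis
  moreover have "\<psi> \<in> borel_measurable borel"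
    using bl by (intro borel_measurable_continuous_onI linear_continuous_on)
  ultimately have "\<phi> ` S \<in> sets borel"
    using S measurable_sets[of \<psi> borel borel S] by simp
  then have leb: "\<phi> ` S \<in> sets lebesgue" by simp
  have derG: "(G has_derivative G' y) (at y within \<phi> ` S)" if y: "y \<in> \<phi> ` S" for y
  proof -
    have "\<psi> y \<in> S" using y \<phi> by auto
    have "(F \<circ> \<psi> has_derivative (*v) (A (\<psi> y)) \<circ> \<psi>) (at y)"
      by (rule diff_chain_at) (simp_all add: bl bounded_linear_imp_has_derivative der[OF \<open>\<psi> y \<in> S\<close>])
    then have "(\<phi> \<circ> (F \<circ> \<psi>) has_derivative \<phi> \<circ> ((*v) (A (\<psi> y)) \<circ> \<psi>)) (at y)"
      by (rule diff_chain_at) (simp add: bl bounded_linear_imp_has_derivative)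
    then show ?thesis
      by (simp add: o_def G_def[abs_def] G'_def has_derivative_at_withinI)
  qed
  have injG: "inj_on G (\<phi> ` S)"
    using inj unfolding inj_on_def G_def by (auto simp: \<phi>) (metis \<phi>(3))
  have cov: "(\<lambda>y. cmod (det (A (\<psi> y))) ^ 2 * h (F (\<psi> y))) absolutely_integrable_on \<phi> ` S \<and>
      integral (\<phi> ` S) (\<lambda>y. cmod (det (A (\<psi> y))) ^ 2 * h (F (\<psi> y))) = b \<longleftrightarrow>
      (\<lambda>y. h (\<psi> y)) absolutely_integrable_on \<phi> ` F ` S \<and> integral (\<phi> ` F ` S) (\<lambda>y. h (\<psi> y)) = b" for b
    using real_valued_change_of_variables[OF leb derG injG, of "\<lambda>y. h (\<psi> y)" b]
    unfolding det G_img by (simp add: G_def \<phi>)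
  note tr = transport[OF meas(1)] transport[OF meas(2)]
  show iff: "set_integrable lborel (F ` S) h \<longleftrightarrow>
      set_integrable lborel S (\<lambda>z. cmod (det (A z)) ^ 2 * h (F z))"
    unfolding tr(1,3) using cov by blast
  show "(LINT w:F ` S|lborel. h w) = (LINT z:S|lborel. cmod (det (A z)) ^ 2 * h (F z))"
  proof (cases "set_integrable lborel (F ` S) h")
    case True
    then have "(\<lambda>y. h (\<psi> y)) absolutely_integrable_on \<phi> ` F ` S" by (simp only: tr(1))
    moreover from this have "(\<lambda>y. cmod (det (A (\<psi> y))) ^ 2 * h (F (\<psi> y))) absolutely_integrable_on \<phi> ` S"
        "integral (\<phi> ` S) (\<lambda>y. cmod (det (A (\<psi> y))) ^ 2 * h (F (\<psi> y))) = integral (\<phi> ` F ` S) (\<lambda>y. h (\<psi> y))"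
      using cov[of "integral (\<phi> ` F ` S) (\<lambda>y. h (\<psi> y))"] by simp_all
    ultimately show ?thesis by (simp only: tr(2) tr(4))
  next
    case False
    then show ?thesis
      using iff by (simp add: set_integrable_def set_lebesgue_integral_def not_integrable_integral_eq)
  qed
qed

section \<open>Circle averages and holomorphy of derivatives\<close>

lemma mholomorphic_line_has_field_derivative:
  assumes "f mholomorphic_on \<Omega>" "z + t *s u \<in> \<Omega>"
  shows "((\<lambda>t. f (z + t *s u)) has_field_derivative vec_apply u f (z + t *s u)) (at t)"
proof -
  have "linear (\<lambda>t. t *s u)"
    by (rule linearI) (auto simp: vec_eq_iff algebra_simps)
  then have "((\<lambda>t. z + t *s u) has_derivative (\<lambda>t. t *s u)) (at t)"
    by (auto intro!: derivative_eq_intros bounded_linear_imp_has_derivative simp: linear_conv_bounded_linear)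
  from diff_chain_at[OF this mholomorphic_has_derivative[OF assms]]
  show ?thesis
    by (simp add: o_def has_field_derivative_def vec_apply_scale mult.commute[of _ "vec_apply u f _"])
qed

lemma mholomorphic_line_holomorphic:
  assumes "f mholomorphic_on \<Omega>" "\<And>t. t \<in> S \<Longrightarrow> z + t *s u \<in> \<Omega>"
  shows "(\<lambda>t. f (z + t *s u)) holomorphic_on S"
  unfolding holomorphic_on_def field_differentiable_def
  using mholomorphic_line_has_field_derivative[OF assms(1) assms(2)] has_field_derivative_at_within by blast

lemma norm_vector_smult: "norm (c *s x :: complex ^ 'n) = cmod c * norm x"
proof -
  have "norm (c *s x) = L2_set (\<lambda>i. cmod c * norm (x $ i)) UNIV"
    by (simp add: norm_vec_def norm_mult)
  then show ?thesis by (simp add: norm_vec_def L2_set_right_distrib)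
qed

text \<open>
  Parametrised by \<open>{0..1}\<close>, so that integrals over the parameter are averages over the circle.
\<close>

abbreviation unit_circle :: "real \<Rightarrow> complex" where
  "unit_circle t \<equiv> exp (2 * of_real pi * \<i> * of_real t)"

text \<open>
  Cauchy's formulas for the value and the first derivative at the centre of the unit disc in the
  complex line through \<open>z\<close> in direction \<open>u\<close>.
\<close>

lemma circle_mean_value:
  assumes f: "f mholomorphic_on \<Omega>" and sub: "\<And>t. cmod t \<le> 1 \<Longrightarrow> z + t *s u \<in> \<Omega>"
  shows "((\<lambda>t. f (z + unit_circle t *s u)) has_integral f z) {0..1}"
    and "((\<lambda>t. f (z + unit_circle t *s u) / unit_circle t) has_integral vec_apply u f z) {0..1}"
proof -
  let ?h = "\<lambda>t. f (z + t *s u)"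
  have hol: "?h holomorphic_on cball 0 1"
    by (rule mholomorphic_line_holomorphic[OF f]) (use sub in auto)
  have vd: "vector_derivative (circlepath 0 1) (at x within {0..1}) = 2 * of_real pi * \<i> * unit_circle x"
    if "x \<in> {0..1}" for x
    using that by (simp add: vector_derivative_circlepath01)
  have cp: "circlepath 0 1 x = unit_circle x" for x
    by (simp add: circlepath mult_ac)
  have "((\<lambda>w. ?h w / (w - 0)) has_contour_integral (2 * of_real pi * \<i> * ?h 0)) (circlepath 0 1)"
    by (rule Cauchy_integral_circlepath_simple[OF hol]) simp
  then have "((\<lambda>x. ?h (unit_circle x) * (2 * of_real pi * \<i>)) has_integral (2 * of_real pi * \<i> * ?h 0)) {0..1}"
    unfolding has_contour_integral_def
    by (rule has_integral_eq[rotated]) (simp add: vd cp)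
  from has_integral_mult_left[OF this, of "inverse (2 * of_real pi * \<i>)"]
  show "((\<lambda>t. f (z + unit_circle t *s u)) has_integral f z) {0..1}"
    by (simp add: field_simps)
  have d1: "(?h has_field_derivative (1 / (2 * of_real pi * \<i>) * contour_integral (circlepath 0 1) (\<lambda>w. ?h w / (w - 0)^2))) (at 0)"
    and ci: "(\<lambda>w. ?h w / (w - 0)^2) contour_integrable_on (circlepath 0 1)"
    by (rule Cauchy_derivative_integral_circlepath[OF holomorphic_on_imp_continuous_on[OF hol]
          holomorphic_on_subset[OF hol ball_subset_cball]]; simp)+
  have d2: "(?h has_field_derivative vec_apply u f (z + 0 *s u)) (at 0)"
    by (rule mholomorphic_line_has_field_derivative[OF f]) (use sub[of 0] in simp)
  from DERIV_unique[OF d1 d2] have "contour_integral (circlepath 0 1) (\<lambda>w. ?h w / (w - 0)^2) = 2 * of_real pi * \<i> * vec_apply u f z"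
    by (simp add: divide_eq_eq mult.commute)
  then have "((\<lambda>w. ?h w / (w - 0)^2) has_contour_integral (2 * of_real pi * \<i> * vec_apply u f z)) (circlepath 0 1)"
    using has_contour_integral_integral[OF ci] by simp
  then have "((\<lambda>x. (?h (unit_circle x) / unit_circle x) * (2 * of_real pi * \<i>)) has_integral (2 * of_real pi * \<i> * vec_apply u f z)) {0..1}"
    unfolding has_contour_integral_def
    by (rule has_integral_eq[rotated]) (simp add: vd cp power2_eq_square)
  from has_integral_mult_left[OF this, of "inverse (2 * of_real pi * \<i>)"]
  show "((\<lambda>t. f (z + unit_circle t *s u) / unit_circle t) has_integral vec_apply u f z) {0..1}"
    by (simp add: field_simps)
qed

lemma cmod_unit_circle: "cmod (unit_circle t) = 1"
  by (simp add: norm_exp_eq_Re)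

lemma continuous_on_circle_translate:
  fixes g :: "complex ^ 'n \<Rightarrow> 'b::topological_space"
  assumes "continuous_on \<Omega> g" "\<And>z t. z \<in> U \<Longrightarrow> z + unit_circle t *s u \<in> \<Omega>"
  shows "continuous_on (U \<times> T) (\<lambda>(z, t). g (z + unit_circle t *s u))"
proof -
  have lin: "linear (\<lambda>t. t *s u)"
    by (rule linearI) (auto simp: vec_eq_iff algebra_simps)
  have "continuous_on (U \<times> T) (\<lambda>p. fst p + unit_circle (snd p) *s u)"
    by (intro continuous_intros linear_continuous_on_compose[OF _ lin])
  from continuous_on_compose2[OF assms(1) this] assms(2) show ?thesis
    by (force simp: case_prod_beta)
qed

text \<open>
  The radius of the circle is fixed while the centre moves near \<open>z0\<close>; this makes the derivative an integral
  over a fixed interval whose integrand depends on \<open>z\<close> only through a translate of \<open>f\<close>. Such an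
  integral is continuous in \<open>z\<close> and can be differentiated under the integral sign.
\<close>

lemma derivative_circle_integral:
  assumes "open \<Omega>" "z0 \<in> \<Omega>"
  obtains r v c where "r > 0" "ball z0 r \<subseteq> \<Omega>"
    and "\<And>z t. z \<in> ball z0 r \<Longrightarrow> cmod t \<le> 1 \<Longrightarrow> z + t *s v \<in> \<Omega>"
    and "\<And>f z. f mholomorphic_on \<Omega> \<Longrightarrow> z \<in> ball z0 r \<Longrightarrow>
      vec_apply u f z = c * integral {0..1} (\<lambda>t. f (z + unit_circle t *s v) / unit_circle t)"
proof -
  obtain R where R: "R > 0" "ball z0 R \<subseteq> \<Omega>" using assms openE by blast
  \<comment> \<open>Scaling \<open>u\<close> by \<open>s\<close> gives a vector of norm at most \<open>R/2\<close>, also when \<open>u = 0\<close>.\<close>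
  define s where "s = R / (2 * (norm u + 1))"
  have "R * norm u \<le> R * (norm u + 1)" "norm u + 1 > 0" using R by (auto simp: add_nonneg_pos)
  then have s: "s > 0" "s * norm u \<le> R / 2"
    using R by (auto simp: s_def field_simps)
  let ?v = "of_real s *s u"
  have in\<Omega>: "z + t *s ?v \<in> \<Omega>" if "z \<in> ball z0 (R/2)" "cmod t \<le> 1" for z t
  proof -
    have "cmod t * (s * norm u) \<le> R / 2"
      using mult_mono[OF that(2) s(2)] s R by simp
    moreover have "dist z0 (z + t *s ?v) \<le> norm (z0 - z) + norm (t *s ?v)"
      using norm_triangle_ineq4[of "z0 - z" "t *s ?v"] by (simp add: dist_norm algebra_simps)
    moreover have "norm (t *s ?v) = cmod t * (s * norm u)"
      using s by (simp add: norm_vector_smult norm_mult)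
    ultimately have "dist z0 (z + t *s ?v) < R"
      using that(1) by (simp add: dist_norm)
    then show ?thesis using R by auto
  qed
  show thesis
  proof (rule that[of "R/2" ?v "inverse (of_real s)"])
    show "ball z0 (R/2) \<subseteq> \<Omega>" using in\<Omega>[of _ 0] by auto
    show "vec_apply u f z = inverse (of_real s) * integral {0..1} (\<lambda>t. f (z + unit_circle t *s ?v) / unit_circle t)"
      if "f mholomorphic_on \<Omega>" "z \<in> ball z0 (R/2)" for f z
      using integral_unique[OF circle_mean_value(2)[OF that(1) in\<Omega>[OF that(2)]]] s
      by (simp add: vec_apply_scale)
  qed (use in\<Omega> R in auto)
qed

lemma continuous_on_circle_integrand:
  fixes g :: "complex ^ 'n \<Rightarrow> complex"
  assumes "continuous_on \<Omega> g" "\<And>z t. z \<in> U \<Longrightarrow> cmod t \<le> 1 \<Longrightarrow> z + t *s v \<in> \<Omega>"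
  shows "continuous_on (U \<times> T) (\<lambda>(z, t). g (z + unit_circle t *s v) / unit_circle t)"
proof -
  have "continuous_on (U \<times> T) (\<lambda>(z, t). g (z + unit_circle t *s v))"
    by (rule continuous_on_circle_translate[OF assms(1)]) (use assms(2) in \<open>auto simp: cmod_unit_circle\<close>)
  then show ?thesis
    unfolding case_prod_beta by (intro continuous_intros) auto
qed

text \<open>
  Holomorphy only asks for a derivative at each point. Its continuity, needed for
  differentiation under the integral sign, comes from the circle integral, whose integrand is continuous.
\<close>

lemma mholomorphic_continuous_vec_apply:
  assumes "open \<Omega>" and f: "f mholomorphic_on \<Omega>"
  shows "continuous_on \<Omega> (vec_apply u f)"
proof (rule continuous_at_imp_continuous_on, rule ballI)
  fix z0 assume "z0 \<in> \<Omega>"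
  then obtain r v c where r: "r > 0" "ball z0 r \<subseteq> \<Omega>"
    and in\<Omega>: "\<And>z t. z \<in> ball z0 r \<Longrightarrow> cmod t \<le> 1 \<Longrightarrow> z + t *s v \<in> \<Omega>"
    and eq: "\<And>f z. f mholomorphic_on \<Omega> \<Longrightarrow> z \<in> ball z0 r \<Longrightarrow>
      vec_apply u f z = c * integral {0..1} (\<lambda>t. f (z + unit_circle t *s v) / unit_circle t)"
    by (rule derivative_circle_integral[OF assms(1), of z0 u]) blast
  have "continuous_on (ball z0 r \<times> cbox 0 1) (\<lambda>(z, t). f (z + unit_circle t *s v) / unit_circle t)"
    by (rule continuous_on_circle_integrand[OF mholomorphic_on_imp_continuous_on[OF f] in\<Omega>])
  from integral_continuous_on_param[OF this]
  have "continuous_on (ball z0 r) (\<lambda>z. c * integral {0..1} (\<lambda>t. f (z + unit_circle t *s v) / unit_circle t))"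
    by (intro continuous_intros) simp
  then have "continuous_on (ball z0 r) (vec_apply u f)"
    by (rule continuous_on_eq) (simp add: eq[OF f])
  then show "isCont (vec_apply u f) z0"
    using r by (simp add: continuous_on_eq_continuous_at)
qed

lemma linear_vec_apply: "linear (\<lambda>h. vec_apply h f z)"
  unfolding vec_apply_def
  by (rule linearI) (auto simp: algebra_simps sum.distrib scaleR_sum_right)

text \<open>
  Differentiation of the circle integral under the integral sign: each integrand has a complex linear
  derivative, hence so has the integral.
\<close>

lemma mholomorphic_on_vec_apply:
  assumes "open \<Omega>" and f: "f mholomorphic_on \<Omega>"
  shows "vec_apply u f mholomorphic_on \<Omega>"
proof -
  have "\<exists>D. (vec_apply u f has_derivative D) (at z0) \<and> (\<forall>c h. D (c *s h) = c * D h)" if "z0 \<in> \<Omega>" for z0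
  proof -
    obtain r v c where r: "r > 0" "ball z0 r \<subseteq> \<Omega>"
      and in\<Omega>: "\<And>z t. z \<in> ball z0 r \<Longrightarrow> cmod t \<le> 1 \<Longrightarrow> z + t *s v \<in> \<Omega>"
      and eq: "\<And>f z. f mholomorphic_on \<Omega> \<Longrightarrow> z \<in> ball z0 r \<Longrightarrow>
        vec_apply u f z = c * integral {0..1} (\<lambda>t. f (z + unit_circle t *s v) / unit_circle t)"
      by (rule derivative_circle_integral[OF assms(1) \<open>z0 \<in> \<Omega>\<close>, of u]) blast
    define k where "k z t = f (z + unit_circle t *s v) / unit_circle t" for z t
    define k' where "k' z t = Blinfun (\<lambda>h. vec_apply h f (z + unit_circle t *s v) / unit_circle t)" for z t
    have k'_apply: "blinfun_apply (k' z t) h = vec_apply h f (z + unit_circle t *s v) / unit_circle t" for z t h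
    proof -
      have "bounded_linear (\<lambda>h. vec_apply h f (z + unit_circle t *s v) / unit_circle t)"
        by (intro bounded_linear_divide[THEN bounded_linear_compose]) (simp add: linear_vec_apply flip: linear_conv_bounded_linear)
      then show ?thesis by (simp add: k'_def bounded_linear_Blinfun_apply)
    qed
    have der: "((\<lambda>z. k z t) has_derivative blinfun_apply (k' z t)) (at z within ball z0 r)"
      if "z \<in> ball z0 r" for z t
    proof -
      have "z + unit_circle t *s v \<in> \<Omega>" using in\<Omega> that by (simp add: cmod_unit_circle)
      moreover have "((\<lambda>z. z + unit_circle t *s v) has_derivative (\<lambda>h. h)) (at z)"
        by (auto intro!: derivative_eq_intros)
      ultimately have "(f \<circ> (\<lambda>z. z + unit_circle t *s v) has_derivative
          (\<lambda>h. vec_apply h f (z + unit_circle t *s v)) \<circ> (\<lambda>h. h)) (at z)"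
        by (intro diff_chain_at mholomorphic_has_derivative[OF f])
      then have "((\<lambda>z. f (z + unit_circle t *s v)) has_derivative
          (\<lambda>h. vec_apply h f (z + unit_circle t *s v))) (at z)"
        by (simp add: o_def)
      from has_derivative_mult_left[OF this, of "inverse (unit_circle t)"]
      have "((\<lambda>z. k z t) has_derivative blinfun_apply (k' z t)) (at z)"
        by (simp add: k_def divide_inverse k'_apply[abs_def])
      then show ?thesis by (rule has_derivative_at_withinI)
    qed
    have cont: "continuous_on (ball z0 r \<times> cbox 0 1) (\<lambda>(z, t). k z t)"
      unfolding k_def
      by (rule continuous_on_circle_integrand[OF mholomorphic_on_imp_continuous_on[OF f] in\<Omega>])
    have int: "k z integrable_on cbox 0 1" if "z \<in> ball z0 r" for z
    proof -
      have "continuous_on (cbox 0 1) (\<lambda>t. (\<lambda>(z, t). k z t) (z, t))"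
        by (rule continuous_on_compose2[OF cont]) (use that in \<open>auto intro!: continuous_intros\<close>)
      then show ?thesis using integrable_continuous by fastforce
    qed
    have cont': "continuous_on (ball z0 r \<times> cbox 0 1) (\<lambda>(z, t). k' z t)"
    proof (rule continuous_on_blinfun_componentwise)
      fix h
      have "continuous_on (ball z0 r \<times> cbox 0 1)
          (\<lambda>(z, t). vec_apply h f (z + unit_circle t *s v) / unit_circle t)"
        by (rule continuous_on_circle_integrand[OF mholomorphic_continuous_vec_apply[OF assms] in\<Omega>])
      then show "continuous_on (ball z0 r \<times> cbox 0 1) (\<lambda>x. blinfun_apply (case x of (z, t) \<Rightarrow> k' z t) h)"
        by (simp add: case_prod_beta k'_apply)
    qed
    have z0: "z0 \<in> ball z0 r" using r by simp
    have int': "k' z0 integrable_on cbox 0 1"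
    proof -
      have "continuous_on (cbox 0 1) (\<lambda>t. (\<lambda>(z, t). k' z t) (z0, t))"
        by (rule continuous_on_compose2[OF cont']) (use z0 in \<open>auto intro!: continuous_intros\<close>)
      then show ?thesis using integrable_continuous by fastforce
    qed
    define D where "D h = c * integral (cbox 0 1) (\<lambda>t. vec_apply h f (z0 + unit_circle t *s v) / unit_circle t)" for h
    have "((\<lambda>z. integral (cbox 0 1) (k z)) has_derivative blinfun_apply (integral (cbox 0 1) (k' z0))) (at z0 within ball z0 r)"
      by (rule leibniz_rule[OF der int cont' z0]) auto
    then have "((\<lambda>z. integral (cbox 0 1) (k z)) has_derivative blinfun_apply (integral (cbox 0 1) (k' z0))) (at z0)"
      using z0 at_within_open[OF z0 open_ball] by simp
    from has_derivative_mult_right[OF this, of c]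
    moreover have "D = (\<lambda>h. c * blinfun_apply (integral (cbox 0 1) (k' z0)) h)"
      unfolding D_def blinfun_apply_integral[OF int'] k'_apply by simp
    ultimately have "((\<lambda>z. c * integral (cbox 0 1) (k z)) has_derivative D) (at z0)"
      by simp
    then have "(vec_apply u f has_derivative D) (at z0)"
      by (rule has_derivative_transform_within_open[OF _ open_ball z0]) (simp add: eq[OF f] k_def[abs_def])
    moreover have "D (a *s h) = a * D h" for a h
      by (simp add: D_def vec_apply_scale flip: times_divide_eq_right)
    ultimately show ?thesis by blast
  qed
  then show ?thesis by (metis mholomorphic_onI)
qed

section \<open>The mean value inequality on balls\<close>

lemma set_lborel_integrable_on_ball:
  fixes h :: "'a::euclidean_space \<Rightarrow> real"
  assumes "continuous_on (cball w d) h"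
  shows "set_integrable lborel (ball w d) h"
proof (rule set_integrable_subset)
  show "set_integrable lborel (cball w d) h"
    unfolding set_integrable_def by (intro borel_integrable_compact assms) simp
qed auto

lemma continuous_on_imp_set_borel_measurable:
  fixes f :: "'a::topological_space \<Rightarrow> 'b::real_normed_vector"
  assumes "A \<in> sets borel" "continuous_on A f"
  shows "set_borel_measurable borel A f"
  unfolding set_borel_measurable_def by (rule borel_measurable_continuous_on_indicator[OF assms])

text \<open>
  Multiplication by \<open>c\<close> is given by a diagonal matrix whose determinant has modulus 1, so the change of
  variables has density 1.
\<close>

lemma ball_integral_rotate:
  fixes h :: "complex ^ 'n \<Rightarrow> real"
  assumes "continuous_on (ball 0 d) h" "cmod c = 1"
  shows "(LINT u:ball 0 d|lborel. h (c *s u)) = (LINT u:ball 0 d|lborel. h u)"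
proof -
  have img: "(*s) c ` ball 0 d = ball (0 :: complex ^ 'n) d"
  proof
    show "(*s) c ` ball 0 d \<subseteq> ball (0 :: complex ^ 'n) d" using assms by (auto simp: norm_vector_smult)
    show "ball (0 :: complex ^ 'n) d \<subseteq> (*s) c ` ball 0 d"
    proof
      fix u :: "complex ^ 'n" assume "u \<in> ball 0 d"
      moreover have "c \<noteq> 0" using assms by auto
      ultimately have "u = c *s (inverse c *s u)" "inverse c *s u \<in> ball 0 d"
        using assms by (auto simp: norm_vector_smult norm_inverse)
      then show "u \<in> (*s) c ` ball 0 d" by blast
    qed
  qed
  let ?A = "diag_matrix (\<lambda>_::'n. c)"
  have A: "?A *v u = c *s u" for u
    by (simp add: vec_eq_iff diag_matrix_vector_mult)
  have det: "cmod (det ?A) = 1"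
    using assms by (simp add: det_diag_matrix norm_power)
  have cont: "continuous_on (ball 0 d) (\<lambda>u. h (c *s u))"
  proof (rule continuous_on_compose2[OF assms(1)])
    show "continuous_on (ball (0 :: complex ^ 'n) d) ((*s) c)"
      using linear_matrix_vector_mult_complex[of ?A] unfolding A
      by (simp add: linear_continuous_on linear_conv_bounded_linear)
  qed (use img in blast)
  have "(LINT u:(*s) c ` ball 0 d|lborel. h u) = (LINT u:ball 0 d|lborel. cmod (det ?A) ^ 2 * h (c *s u))"
  proof (rule complex_change_of_variables(2))
    show "inj_on ((*s) c) (ball 0 d)" using assms by (auto simp: inj_on_def)
    show "((*s) c has_derivative (*v) ?A) (at z)" for z
      unfolding A[abs_def] using linear_matrix_vector_mult_complex[of ?A] unfolding A
      by (simp add: bounded_linear_imp_has_derivative linear_conv_bounded_linear)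
  qed (auto simp: img det intro!: continuous_on_imp_set_borel_measurable assms cont)
  then show ?thesis by (simp add: img det)
qed

lemma ball_integral_translate:
  fixes h :: "'a::euclidean_space \<Rightarrow> real"
  assumes "continuous_on (ball w d) h"
  shows "(LINT u:ball 0 d|lborel. h (w + u)) = (LINT u:ball w d|lborel. h u)"
proof -
  have meas: "(\<lambda>u. indicator (ball w d) u *\<^sub>R h u) \<in> borel_measurable borel"
    by (rule borel_measurable_continuous_on_indicator[OF _ assms]) simp
  have "(LINT u:ball w d|lborel. h u) = (LINT u|distr lborel borel ((+) w). indicator (ball w d) u *\<^sub>R h u)"
    by (simp add: set_lebesgue_integral_def lborel_distr_plus)
  also have "\<dots> = (LINT u|lborel. indicator (ball w d) (w + u) *\<^sub>R h (w + u))"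
    by (rule integral_distr[OF _ meas]) simp
  also have "(\<lambda>u. indicator (ball w d) (w + u) *\<^sub>R h (w + u)) = (\<lambda>u. indicator (ball 0 d) u *\<^sub>R h (w + u))"
    by (auto simp: indicator_def dist_norm)
  finally show ?thesis by (simp add: set_lebesgue_integral_def)
qed

text \<open>
  On every complex line through the centre, the average of \<open>\<bar>f\<bar>\<close> over a circle dominates \<open>\<bar>f\<bar>\<close> at the centre. Since
  the integral over the ball does not change under the rotations \<open>u \<mapsto> e\<^sup>i\<^sup>t u\<close>, averaging it over \<open>t\<close> and
  exchanging the integrals by Tonelli's theorem gives the inequality.
\<close>

lemma ball_mean_value_inequality:
  fixes f :: "complex ^ 'n \<Rightarrow> complex"
  assumes f: "f mholomorphic_on \<Omega>" and sub: "cball w d \<subseteq> \<Omega>"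
  shows "cmod (f w) * measure lborel (ball w d) \<le> (LINT u:ball w d|lborel. cmod (f u))"
proof -
  have contf: "continuous_on (cball w d) f"
    using mholomorphic_on_imp_continuous_on[OF f] sub continuous_on_subset by blast
  define h where "h u = cmod (f (w + u))" for u
  have conth: "continuous_on (cball 0 d) h"
    unfolding h_def by (intro continuous_intros continuous_on_compose2[OF contf]) (auto simp: dist_norm)
  have conth': "continuous_on (ball 0 d) h"
    using conth continuous_on_subset ball_subset_cball by blast
  define I where "I = (LINT u:ball 0 d|lborel. h u)"
  define H where "H t u = ennreal (indicator {0..1} t * (indicator (ball 0 d) u * h (unit_circle t *s u)))" for t :: real and u
  have circ: "continuous_on ({0..1} \<times> ball 0 d) (\<lambda>p. h (unit_circle (fst p) *s snd p))"
  proof (rule continuous_on_compose2[OF conth'])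
    show "continuous_on ({0..1} \<times> ball 0 d) (\<lambda>p. unit_circle (fst p) *s snd p)"
      unfolding vector_scalar_mult_def by (intro continuous_intros)
  qed (auto simp: norm_vector_smult cmod_unit_circle)
  have meas: "case_prod H \<in> borel_measurable (lborel \<Otimes>\<^sub>M lborel)"
  proof -
    have "(\<lambda>p. indicator ({0..1} \<times> ball 0 d) p *\<^sub>R h (unit_circle (fst p) *s snd p)) \<in> borel_measurable borel"
      by (rule borel_measurable_continuous_on_indicator[OF _ circ]) (auto intro!: borel_Times)
    moreover have "case_prod H = (\<lambda>p. ennreal (indicator ({0..1} \<times> ball 0 d) p *\<^sub>R h (unit_circle (fst p) *s snd p)))"
      by (auto simp: H_def fun_eq_iff indicator_def)
    ultimately show ?thesis by (simp add: lborel_prod)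
  qed
  have rot: "(\<integral>\<^sup>+u. H t u \<partial>lborel) = ennreal I * indicator {0..1} t" for t
  proof (cases "t \<in> {0..1}")
    case True
    have "continuous_on (cball 0 d) ((*s) (unit_circle t) :: complex ^ 'n \<Rightarrow> _)"
      unfolding vector_scalar_mult_def by (intro continuous_intros)
    then have "continuous_on (cball 0 d) (\<lambda>u. h (unit_circle t *s u))"
      by (rule continuous_on_compose2[OF conth]) (auto simp: norm_vector_smult cmod_unit_circle)
    then have int: "integrable lborel (\<lambda>u. indicator (ball 0 d) u * h (unit_circle t *s u))"
      using set_lborel_integrable_on_ball[of 0 d] by (simp add: set_integrable_def)
    have "(\<integral>\<^sup>+u. H t u \<partial>lborel) = ennreal (LINT u|lborel. indicator (ball 0 d) u * h (unit_circle t *s u))"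
      using True unfolding H_def by (simp, intro nn_integral_eq_integral[OF int]) (simp add: h_def)
    also have "(LINT u|lborel. indicator (ball 0 d) u * h (unit_circle t *s u)) = I"
      using ball_integral_rotate[OF conth' cmod_unit_circle] by (simp add: set_lebesgue_integral_def I_def)
    finally show ?thesis using True by simp
  qed (simp add: H_def)
  have circle: "ennreal (cmod (f w)) * indicator (ball 0 d) u \<le> (\<integral>\<^sup>+t. H t u \<partial>lborel)" for u
  proof (cases "u \<in> ball 0 d")
    case True
    have in\<Omega>: "w + t *s u \<in> cball w d" if "cmod t \<le> 1" for t
      using mult_mono[OF that, of "norm u" d] True by (simp add: dist_norm norm_vector_smult)
    have c: "continuous_on {0..1} (\<lambda>t. f (w + unit_circle t *s u))"
      by (rule continuous_on_compose2[OF contf])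
         (use in\<Omega> in \<open>auto simp: cmod_unit_circle vector_scalar_mult_def intro!: continuous_intros\<close>)
    then have c': "continuous_on {0..1} (\<lambda>t. h (unit_circle t *s u))"
      unfolding h_def by (rule continuous_on_norm)
    have "((\<lambda>t. f (w + unit_circle t *s u)) has_integral f w) {0..1}"
      by (rule circle_mean_value(1)[OF f]) (use in\<Omega> sub in blast)
    then have "cmod (f w) = cmod (integral {0..1} (\<lambda>t. f (w + unit_circle t *s u)))"
      by (simp add: integral_unique)
    also have "\<dots> \<le> integral {0..1} (\<lambda>t. h (unit_circle t *s u))"
      unfolding h_def by (rule integral_norm_bound_integral)
         (use c c' in \<open>auto simp: h_def intro: integrable_continuous_real\<close>)
    also have "\<dots> = (LINT t:{0..1}|lborel. h (unit_circle t *s u))"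
      by (rule set_borel_integral_eq_integral(2)[symmetric, OF borel_integrable_atLeastAtMost'[OF c']])
    finally have "ennreal (cmod (f w)) \<le> ennreal (LINT t|lborel. indicator {0..1} t * h (unit_circle t *s u))"
      by (simp add: set_lebesgue_integral_def ennreal_leI)
    also have "\<dots> = (\<integral>\<^sup>+t. H t u \<partial>lborel)"
      using True borel_integrable_atLeastAtMost'[OF c'] unfolding H_def
      by (simp, intro nn_integral_eq_integral[symmetric]) (auto simp: h_def set_integrable_def)
    finally show ?thesis using True by simp
  qed simp
  have "ennreal (cmod (f w)) * emeasure lborel (ball (0::complex^'n) d) = (\<integral>\<^sup>+u. ennreal (cmod (f w)) * indicator (ball (0::complex^'n) d) u \<partial>lborel)"
    by (simp add: nn_integral_cmult_indicator)
  also have "\<dots> \<le> (\<integral>\<^sup>+u. (\<integral>\<^sup>+t. H t u \<partial>lborel) \<partial>lborel)"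
    by (intro nn_integral_mono circle)
  also have "\<dots> = (\<integral>\<^sup>+t. (\<integral>\<^sup>+u. H t u \<partial>lborel) \<partial>lborel)"
    by (rule lborel_pair.Fubini'[OF meas])
  also have "\<dots> = ennreal I"
    unfolding rot by (subst nn_integral_cmult_indicator) auto
  finally have "ennreal (cmod (f w)) * ennreal (measure lborel (ball (0::complex^'n) d)) \<le> ennreal I"
    using emeasure_lborel_ball_finite[of "0 :: complex^'n" d]
    by (simp add: emeasure_eq_ennreal_measure less_top[symmetric])
  moreover have "I \<ge> 0" unfolding I_def set_lebesgue_integral_def
    by (intro Bochner_Integration.integral_nonneg) (auto simp: h_def)
  moreover have "I = (LINT u:ball w d|lborel. cmod (f u))"
    unfolding I_def h_def
    by (rule ball_integral_translate) (intro continuous_on_norm continuous_on_subset[OF contf] ball_subset_cball)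
  moreover have "measure lborel (ball (0::complex^'n) d) = measure lborel (ball w d)"
    by (cases "d \<ge> 0") (simp_all add: content_ball ball_empty)
  ultimately show ?thesis
    by (simp flip: ennreal_mult)
qed

section \<open>Local bounds in Bergman spaces\<close>

text \<open>
  Common step of the two ranges of \<open>p\<close> below: a pointwise bound of \<open>\<bar>f\<bar>\<close> by \<open>\<bar>f\<bar>\<^sup>p\<close> on a ball turns the
  mean value inequality into a bound at the centre.
\<close>

lemma ball_Lp_bound:
  fixes f :: "complex ^ 'n \<Rightarrow> complex"
  assumes f: "f mholomorphic_on \<Omega>" and sub: "cball w d \<subseteq> \<Omega>"
    and int: "set_integrable lborel \<Omega> (\<lambda>u. cmod (f u) powr p)"
    and le1: "(LINT u:\<Omega>|lborel. cmod (f u) powr p) \<le> 1"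
    and K: "K \<ge> 0" and bound: "\<And>u. u \<in> ball w d \<Longrightarrow> cmod (f u) \<le> a + K * cmod (f u) powr p"
  shows "cmod (f w) * measure lborel (ball w d) \<le> a * measure lborel (ball w d) + K"
proof -
  have contf: "continuous_on (cball w d) f"
    using mholomorphic_on_imp_continuous_on[OF f] sub continuous_on_subset by blast
  have intB: "set_integrable lborel (ball w d) (\<lambda>u. cmod (f u) powr p)"
    by (rule set_integrable_subset[OF int]) (use sub in auto)
  have a: "set_integrable lborel (ball w d) (\<lambda>u. a)"
    by (intro set_lborel_integrable_on_ball continuous_intros)
  have "(LINT u:ball w d|lborel. cmod (f u) powr p) \<le> (LINT u:\<Omega>|lborel. cmod (f u) powr p)"
    unfolding set_lebesgue_integral_def
  proof (rule integral_mono)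
    show "indicator (ball w d) u *\<^sub>R (cmod (f u) powr p) \<le> indicator \<Omega> u *\<^sub>R (cmod (f u) powr p)" for u
      using sub by (auto simp: indicator_def subset_iff)
  qed (use int intB in \<open>simp_all add: set_integrable_def\<close>)
  with le1 have L: "(LINT u:ball w d|lborel. cmod (f u) powr p) \<le> 1" by linarith
  have "cmod (f w) * measure lborel (ball w d) \<le> (LINT u:ball w d|lborel. cmod (f u))"
    by (rule ball_mean_value_inequality[OF f sub])
  also have "\<dots> \<le> (LINT u:ball w d|lborel. a + K * cmod (f u) powr p)"
    by (rule set_integral_mono)
       (use a intB bound in \<open>auto intro!: set_lborel_integrable_on_ball continuous_on_norm contf set_integral_add\<close>)
  also have "\<dots> = (LINT u:ball w d|lborel. a) + K * (LINT u:ball w d|lborel. cmod (f u) powr p)"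
    using a intB by (subst set_integral_add) auto
  also have "(LINT u:ball w d|lborel. a) = a * measure lborel (ball w d)"
    by (simp add: set_lebesgue_integral_def)
  also have "K * (LINT u:ball w d|lborel. cmod (f u) powr p) \<le> K"
    using mult_left_mono[OF L K] by simp
  finally show ?thesis by simp
qed

text \<open>
  For \<open>p \<ge> 1\<close> the inequality \<open>x \<le> 1 + x\<^sup>p\<close> suffices. For \<open>p < 1\<close> the weighted modulus
  \<open>\<bar>f u\<bar> (R - \<bar>z - u\<bar>)\<^sup>s\<close> with \<open>s p = N\<close>, the real dimension, is maximised over the closed ball. Near a
  maximum point the distance to the sphere is at least half of that at the maximum point, so \<open>\<bar>f\<bar>\<close> is at most a constant \<open>L\<close> there and
  \<open>\<bar>f\<bar> \<le> L\<^sup>1\<^sup>-\<^sup>p \<bar>f\<bar>\<^sup>p\<close>. The mean value inequality then bounds the \<open>p\<close>-th power of the maximum; the choice of \<open>s\<close>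
  makes the radius cancel.
\<close>

lemma Lp_ball_locally_bounded:
  fixes \<Omega> :: "(complex ^ 'n) set"
  assumes p: "p > 0" and \<Omega>: "open \<Omega>" "z \<in> \<Omega>"
  obtains r C where "r > 0" "cball z r \<subseteq> \<Omega>"
    "\<And>f w. f \<in> bergman_space \<Omega> p \<Longrightarrow> (LINT u:\<Omega>|lborel. cmod (f u) powr p) \<le> 1 \<Longrightarrow>
      w \<in> cball z r \<Longrightarrow> cmod (f w) \<le> C"
proof -
  obtain R where R: "R > 0" "cball z R \<subseteq> \<Omega>" using \<Omega> open_contains_cball by blast
  have half: "cball z (R/2) \<subseteq> \<Omega>" using R subset_cball[of "R/2" R z] by auto
  define N where "N = DIM(complex ^ 'n)"
  have N: "N > 0" by (simp add: N_def)
  define V where "V = unit_ball_vol (real N)"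
  have V: "V > 0" by (simp add: V_def)
  have vol: "measure lborel (ball w d) = V * d ^ N" if "d \<ge> 0" for w :: "complex ^ 'n" and d
    using content_ball[OF that, of w] by (simp add: V_def N_def)
  show thesis
  proof (cases "p \<ge> 1")
    case True
    have "cmod (f w) \<le> 1 + 1 / (V * (R/2) ^ N)"
      if f: "f \<in> bergman_space \<Omega> p" "(LINT u:\<Omega>|lborel. cmod (f u) powr p) \<le> 1"
        and w: "w \<in> cball z (R/2)" for f w
    proof -
      have "cball w (R/2) \<subseteq> cball z R"
        using w by (simp add: cball_subset_cball_iff dist_commute)
      then have sub: "cball w (R/2) \<subseteq> \<Omega>" using R by blast
      have x: "x \<le> 1 + 1 * x powr p" if "x \<ge> 0" for x :: real
        using that powr_mono[OF True, of x] by (cases "x \<le> 1") (auto simp: add_increasing2)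
      have "cmod (f w) * (V * (R/2) ^ N) \<le> 1 * (V * (R/2) ^ N) + 1"
        using ball_Lp_bound[OF _ sub _ f(2), of 1 1] f R x by (simp add: bergman_space_def vol)
      moreover define Q where "Q = V * (R/2) ^ N"
      moreover have "Q > 0" unfolding Q_def using V R by simp
      ultimately show ?thesis unfolding Q_def[symmetric] by (simp add: field_simps)
    qed
    from this show thesis
      by - (rule that[of "R/2"], use R in simp, rule half, assumption)
  next
    case False
    define s where "s = real N / p"
    have s: "s > 0" "s * p = real N" using p N by (auto simp: s_def)
    define M0 where "M0 = (2 powr s / V) powr (1 / p)"
    have "cmod (f w) \<le> M0 / (R/2) powr s"
      if f: "f \<in> bergman_space \<Omega> p" "(LINT u:\<Omega>|lborel. cmod (f u) powr p) \<le> 1"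
        and w: "w \<in> cball z (R/2)" for f w
    proof -
      have fh: "f mholomorphic_on \<Omega>" and fi: "set_integrable lborel \<Omega> (\<lambda>u. cmod (f u) powr p)"
        using f by (auto simp: bergman_space_def)
      define g where "g u = cmod (f u) * (R - dist z u) powr s" for u
      have "continuous_on (cball z R) g"
        unfolding g_def using s R
        by (intro continuous_intros continuous_on_powr' continuous_on_subset[OF mholomorphic_on_imp_continuous_on[OF fh]]) auto
      then obtain w0 where w0: "w0 \<in> cball z R" and max: "\<And>u. u \<in> cball z R \<Longrightarrow> g u \<le> g w0"
        using continuous_attains_sup[OF compact_cball, of z R g] R by force
      define M where "M = g w0"
      have "M \<le> M0"
      proof (cases "M > 0")
        case False
        moreover have "M0 \<ge> 0" by (simp add: M0_def)
        ultimately show ?thesis by linarith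
      next
        case True
        \<comment> \<open>Half the distance from \<open>w0\<close> to the sphere: the ball of radius \<open>d\<close> about \<open>w0\<close> keeps distance \<open>d\<close> from it.\<close>
        define d where "d = (R - dist z w0) / 2"
        have "dist z w0 \<noteq> R" using True s by (auto simp: M_def g_def)
        then have d: "d > 0" using w0 by (simp add: d_def)
        define L where "L = M * d powr (- s)"
        have L: "L > 0" using True d by (simp add: L_def)
        have "cball w0 d \<subseteq> cball z R"
          using d by (simp add: cball_subset_cball_iff d_def dist_commute field_simps)
        then have sub: "cball w0 d \<subseteq> \<Omega>" and subR: "ball w0 d \<subseteq> cball z R" using R ball_subset_cball by blast+
        have bound: "cmod (f u) \<le> 0 + L powr (1 - p) * cmod (f u) powr p" if u: "u \<in> ball w0 d" for u
        proof (cases "f u = 0")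
          case nz: False
          have "d \<le> R - dist z u"
            using u dist_triangle[of z u w0] by (simp add: d_def dist_commute field_simps)
          then have "cmod (f u) * d powr s \<le> g u"
            unfolding g_def using d s by (intro mult_left_mono powr_mono2) auto
          also have "\<dots> \<le> M" unfolding M_def using max subR u by blast
          finally have "cmod (f u) \<le> L"
            using d by (simp add: L_def powr_minus field_simps)
          then have "cmod (f u) powr (1 - p) \<le> L powr (1 - p)"
            using \<open>\<not> p \<ge> 1\<close> by (intro powr_mono2) auto
          then have "cmod (f u) powr (1 - p) * cmod (f u) powr p \<le> L powr (1 - p) * cmod (f u) powr p"
            by (intro mult_right_mono) auto
          then show ?thesis using nz by (simp flip: powr_add)
        qed simp
        have "cmod (f w0) * (V * d ^ N) \<le> L powr (1 - p)"
          using ball_Lp_bound[OF fh sub fi f(2) _ bound] d by (simp add: vol)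
        moreover have "cmod (f w0) = L / 2 powr s"
        proof -
          have "R - dist z w0 = 2 * d" by (simp add: d_def)
          then have "M = cmod (f w0) * (2 * d) powr s" by (simp add: M_def g_def)
          then show ?thesis using d by (simp add: L_def powr_mult powr_minus field_simps)
        qed
        ultimately have "L powr 1 / 2 powr s * (V * d ^ N) \<le> L powr (1 - p)" using L by simp
        then have "L powr p * L powr (1 - p) * (V * d ^ N) \<le> 2 powr s * L powr (1 - p)"
          by (simp add: field_simps flip: powr_add)
        then have "L powr p * d ^ N \<le> 2 powr s / V"
          using L V by (simp add: field_simps)
        moreover have "L powr p * d ^ N = M powr p"
          using True d s(2) by (simp add: L_def powr_mult powr_powr flip: powr_realpow powr_add)
        ultimately have "(M powr p) powr (1 / p) \<le> M0"
          unfolding M0_def using p by (intro powr_mono2) auto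
        then show ?thesis using True p by (simp add: powr_powr)
      qed
      have "R/2 \<le> R - dist z w" using w by simp
      then have "cmod (f w) * (R/2) powr s \<le> g w"
        unfolding g_def using R s by (intro mult_left_mono powr_mono2) auto
      also have "\<dots> \<le> M0" using max[of w] w R \<open>M \<le> M0\<close> by (simp add: M_def)
      finally show ?thesis using R by (simp add: field_simps)
    qed
    from this show thesis
      by - (rule that[of "R/2"], use R in simp, rule half, assumption)
  qed
qed

text \<open>
  Cauchy's estimate on the complex line in direction \<open>X\<close>.
\<close>

lemma vec_apply_bound:
  assumes f: "f mholomorphic_on \<Omega>" and r: "r > 0" "cball z r \<subseteq> \<Omega>"
    and C: "\<And>w. w \<in> cball z r \<Longrightarrow> cmod (f w) \<le> C"
  shows "cmod (vec_apply X f z) \<le> C * (norm X + 1) / r"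
proof -
  define s where "s = r / (norm X + 1)"
  have X: "norm X + 1 > 0" by (simp add: add_nonneg_pos)
  have s: "s > 0" "s * norm X \<le> r" using r X by (auto simp: s_def field_simps)
  have in_ball: "z + t *s (of_real s *s X) \<in> cball z r" if "cmod t \<le> 1" for t
    using mult_mono[OF that s(2)] s r
    by (simp add: dist_norm norm_vector_smult norm_mult mult.assoc del: vector_smult_assoc)
  have "cmod (vec_apply (of_real s *s X) f z) \<le> C * measure lborel (cbox 0 (1::real))"
  proof (rule has_integral_bound)
    show "((\<lambda>t. f (z + unit_circle t *s (of_real s *s X)) / unit_circle t) has_integral vec_apply (of_real s *s X) f z) (cbox 0 1)"
      unfolding cbox_interval by (rule circle_mean_value(2)[OF f]) (use in_ball r(2) in blast)
    show "0 \<le> C" using C[of z] r norm_ge_zero order_trans by (metis centre_in_cball less_imp_le)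
    show "norm (f (z + unit_circle x *s (of_real s *s X)) / unit_circle x) \<le> C" for x
      using C[OF in_ball] by (simp add: norm_divide cmod_unit_circle del: vector_smult_assoc)
  qed
  then have "s * cmod (vec_apply X f z) \<le> C" using s by (simp add: vec_apply_scale norm_mult)
  then show ?thesis using s r X by (simp add: s_def field_simps)
qed

section \<open>The Jacobian determinant and its powers\<close>

definition jacobian :: "(complex ^ 'n \<Rightarrow> complex ^ 'm) \<Rightarrow> complex ^ 'n \<Rightarrow> complex ^ 'n ^ 'm" where
  "jacobian F z = (\<chi> k j. cpartial j (\<lambda>w. F w $ k) z)"

lemma jacobian_mult_vector: "jacobian F z *v X = push_forward F z X"
  by (simp add: vec_eq_iff jacobian_def push_forward_def vec_apply_def matrix_vector_mult_def mult.commute)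

lemma cpartial_eq_vec_apply: "cpartial j f z = vec_apply (axis j 1) f z"
proof -
  have "vec_apply (axis j 1) f z = (\<Sum>i\<in>UNIV. if i = j then cpartial j f z else 0)"
    unfolding vec_apply_def by (intro sum.cong) (auto simp: axis_def)
  then show ?thesis by simp
qed

lemma mholomorphic_on_det_jacobian:
  fixes F :: "complex ^ 'n \<Rightarrow> complex ^ 'n"
  assumes "open \<Omega>" "holomorphic_map_on F \<Omega>"
  shows "(\<lambda>z. det (jacobian F z)) mholomorphic_on \<Omega>"
proof -
  have "(\<lambda>z. jacobian F z $ k $ j) mholomorphic_on \<Omega>" for k j
    using mholomorphic_on_vec_apply[OF assms(1), of "\<lambda>w. F w $ k" "axis j 1"] assms(2)
    by (simp add: jacobian_def cpartial_eq_vec_apply[abs_def] holomorphic_map_on_def)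
  then show ?thesis
    unfolding det_def by (intro mholomorphic_on_sum mholomorphic_on_mult mholomorphic_on_prod) auto
qed

lemma push_forward_inverse:
  fixes F :: "complex ^ 'n \<Rightarrow> complex ^ 'm"
  assumes "open \<Omega>" "holomorphic_map_on F \<Omega>" "holomorphic_map_on G \<Omega>'" "F ` \<Omega> \<subseteq> \<Omega>'"
    and inv: "\<And>z. z \<in> \<Omega> \<Longrightarrow> G (F z) = z" and z: "z \<in> \<Omega>"
  shows "push_forward G (F z) (push_forward F z X) = X"
proof -
  have "F z \<in> \<Omega>'" using assms by blast
  from diff_chain_at[OF holomorphic_map_has_derivative[OF assms(2) z] holomorphic_map_has_derivative[OF assms(3) this]]
  have "((\<lambda>z. z) has_derivative push_forward G (F z) \<circ> push_forward F z) (at z)"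
    by (rule has_derivative_transform_within_open[OF _ assms(1) z]) (simp add: inv)
  from has_derivative_unique[OF this has_derivative_ident] show ?thesis
    by (metis comp_apply)
qed

text \<open>
  By the chain rule the Jacobian matrix of the inverse map is a left inverse.
\<close>

lemma det_jacobian_nonzero:
  fixes F :: "complex ^ 'n \<Rightarrow> complex ^ 'n"
  assumes "open \<Omega>1" "biholomorphic_map F \<Omega>1 \<Omega>2" "z \<in> \<Omega>1"
  shows "det (jacobian F z) \<noteq> 0"
proof -
  let ?G = "inv_into \<Omega>1 F"
  have "jacobian ?G (F z) *v (jacobian F z *v X) = X" for X
    unfolding jacobian_mult_vector
    by (rule push_forward_inverse[OF assms(1)])
       (use assms in \<open>auto simp: biholomorphic_map_def bij_betw_def\<close>)
  then have "jacobian ?G (F z) ** jacobian F z = mat 1"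
    by (simp add: matrix_eq matrix_vector_mul_assoc)
  then have "det (jacobian ?G (F z)) * det (jacobian F z) = 1"
    by (metis det_mul det_I)
  then show ?thesis by auto
qed

text \<open>
  Near a point \<open>z0\<close> a continuous logarithm differs from \<open>L z0\<close> by less than \<open>pi\<close>, so there it equals
  \<open>L z0 + Ln (J z / J z0)\<close> for the principal branch \<open>Ln\<close>, which is holomorphic near 1.
\<close>

lemma mholomorphic_on_logarithm:
  assumes "open \<Omega>" "J mholomorphic_on \<Omega>" and L: "continuous_on \<Omega> L"
    and exp: "\<And>z. z \<in> \<Omega> \<Longrightarrow> J z = exp (L z)"
  shows "L mholomorphic_on \<Omega>"
proof -
  have "L mholomorphic_on {z0}" if z0: "z0 \<in> \<Omega>" for z0
  proof -
    define U where "U = \<Omega> \<inter> L -` ball (L z0) 1"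
    have "open U" unfolding U_def by (rule continuous_open_preimage[OF L assms(1) open_ball])
    have eq: "L z0 + Ln (J z * inverse (J z0)) = L z" if "z \<in> U" for z
    proof -
      have "cmod (L z - L z0) < 1" using that by (simp add: U_def dist_norm norm_minus_commute)
      then have "\<bar>Im (L z - L z0)\<bar> < pi"
        using abs_Im_le_cmod[of "L z - L z0"] pi_gt3 by linarith
      then have "Ln (exp (L z - L z0)) = L z - L z0"
        by (intro Ln_exp) (auto simp: abs_less_iff)
      moreover have "exp (L z - L z0) = J z * inverse (J z0)"
        using that z0 by (simp add: U_def exp exp_diff divide_inverse)
      ultimately show ?thesis by simp
    qed
    have "J z0 \<noteq> 0" using exp z0 by simp
    have "(\<lambda>z. L z0 + Ln (J z * inverse (J z0))) mholomorphic_on {z0}"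
    proof (intro mholomorphic_on_add mholomorphic_on_const)
      have "(\<lambda>z. J z * inverse (J z0)) mholomorphic_on {z0}"
        using mholomorphic_on_subset[OF assms(2)] z0 by (intro mholomorphic_on_mult mholomorphic_on_const) auto
      then show "(\<lambda>z. Ln (J z * inverse (J z0))) mholomorphic_on {z0}"
        by (rule mholomorphic_on_compose_field)
           (use \<open>J z0 \<noteq> 0\<close> in \<open>auto intro!: has_field_derivative_Ln\<close>)
    qed
    from mholomorphic_has_derivative[OF this, of z0]
    have "(L has_derivative (\<lambda>h. vec_apply h (\<lambda>z. L z0 + Ln (J z * inverse (J z0))) z0)) (at z0)"
      by (rule has_derivative_transform_within_open[OF _ \<open>open U\<close>]) (use z0 eq in \<open>simp_all add: U_def\<close>)
    then show ?thesis
      by (intro mholomorphic_onI[where D = "\<lambda>_ h. vec_apply h _ z0"]) (simp_all add: vec_apply_scale)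
  qed
  then show ?thesis by (auto simp: mholomorphic_on_def)
qed

text \<open>
  On a simply connected domain \<open>J\<close> lifts along the covering \<open>exp\<close> of the punctured plane; the lift,
  multiplied by \<open>2/p\<close>, is exponentiated again.
\<close>

lemma holomorphic_root_simply_connected:
  assumes "open \<Omega>" "simply_connected \<Omega>" and J: "J mholomorphic_on \<Omega>" "\<And>z. z \<in> \<Omega> \<Longrightarrow> J z \<noteq> 0"
    and p: "p > 0"
  obtains g where "g mholomorphic_on \<Omega>" "\<And>z. z \<in> \<Omega> \<Longrightarrow> cmod (g z) powr p = cmod (J z) ^ 2"
proof -
  obtain L where L: "continuous_on \<Omega> L" "\<And>z. z \<in> \<Omega> \<Longrightarrow> J z = exp (L z)"
    using continuous_logarithm_on_simply_connected[OF mholomorphic_on_imp_continuous_on[OF J(1)] assms(2)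
      open_imp_locally_path_connected[OF assms(1)] J(2)] by blast
  have "(\<lambda>z. of_real (2 / p) * L z) mholomorphic_on \<Omega>"
    by (intro mholomorphic_on_mult mholomorphic_on_const mholomorphic_on_logarithm[OF assms(1) J(1) L])
  then have "(\<lambda>z. exp (of_real (2 / p) * L z)) mholomorphic_on \<Omega>"
    by (rule mholomorphic_on_compose_field) (rule DERIV_exp)
  moreover have "cmod (exp (of_real (2 / p) * L z)) powr p = cmod (J z) ^ 2" if "z \<in> \<Omega>" for z
  proof -
    have "cmod (exp (of_real (2 / p) * L z)) = exp (2 / p * Re (L z))"
      by (simp add: norm_exp_eq_Re)
    then have "cmod (exp (of_real (2 / p) * L z)) powr p = exp (2 * Re (L z))"
      using p by (simp add: powr_def)
    also have "\<dots> = cmod (J z) ^ 2"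
      using L(2)[OF that] by (simp add: norm_exp_eq_Re exp_double)
    finally show ?thesis .
  qed
  ultimately show thesis by (rule that)
qed

lemma holomorphic_root_integer_exponent:
  assumes J: "J mholomorphic_on \<Omega>" "\<And>z. z \<in> \<Omega> \<Longrightarrow> J z \<noteq> 0" and p: "p > 0" "2 / p = real m"
  obtains g where "g mholomorphic_on \<Omega>" "\<And>z. z \<in> \<Omega> \<Longrightarrow> cmod (g z) powr p = cmod (J z) ^ 2"
proof (rule that)
  show "(\<lambda>z. J z ^ m) mholomorphic_on \<Omega>" by (rule mholomorphic_on_power[OF J(1)])
  show "cmod (J z ^ m) powr p = cmod (J z) ^ 2" if "z \<in> \<Omega>" for z
  proof -
    have "real m * p = 2" using p by (simp add: field_simps)
    have pos: "cmod (J z) > 0" using J(2)[OF that] by simp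
    have "cmod (J z ^ m) powr p = (cmod (J z) powr real m) powr p"
      by (simp only: norm_power powr_realpow[OF pos])
    also have "\<dots> = cmod (J z) powr 2"
      by (simp only: powr_powr \<open>real m * p = 2\<close>)
    also have "\<dots> = cmod (J z) ^ 2" using pos by simp
    finally show ?thesis .
  qed
qed

section \<open>The extremal problems behind the metric\<close>

lemma vec_apply_cong:
  assumes "open \<Omega>" "z \<in> \<Omega>" "f mholomorphic_on \<Omega>" "\<And>w. w \<in> \<Omega> \<Longrightarrow> f w = g w"
  shows "vec_apply X f z = vec_apply X g z"
proof -
  have "(g has_derivative (\<lambda>h. vec_apply h f z)) (at z)"
    by (rule has_derivative_transform_within_open[OF mholomorphic_has_derivative[OF assms(3,2)] assms(1,2)])
       (rule assms(4))
  then show ?thesis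
    by (rule vec_apply_unique[symmetric, OF _ mholomorphic_on_cong[OF assms(1,4,3)] assms(2)])
qed

lemma vec_apply_mult:
  assumes "f mholomorphic_on \<Omega>" "g mholomorphic_on \<Omega>" "z \<in> \<Omega>"
  shows "vec_apply X (\<lambda>w. f w * g w) z = f z * vec_apply X g z + vec_apply X f z * g z"
  by (rule vec_apply_unique[OF has_derivative_mult[OF mholomorphic_has_derivative[OF assms(1,3)]
        mholomorphic_has_derivative[OF assms(2,3)]] mholomorphic_on_mult[OF assms(1,2)] assms(3)])

lemma bergman_space_cong:
  assumes "open \<Omega>" "\<And>z. z \<in> \<Omega> \<Longrightarrow> f z = g z"
  shows "f \<in> bergman_space \<Omega> p \<longleftrightarrow> g \<in> bergman_space \<Omega> p" "Lp_norm \<Omega> p f = Lp_norm \<Omega> p g"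
proof -
  have "f mholomorphic_on \<Omega> \<longleftrightarrow> g mholomorphic_on \<Omega>"
    using mholomorphic_on_cong[OF assms(1), of f g] mholomorphic_on_cong[OF assms(1), of g f] assms(2) by auto
  moreover have "set_integrable lborel \<Omega> (\<lambda>w. cmod (f w) powr p) \<longleftrightarrow> set_integrable lborel \<Omega> (\<lambda>w. cmod (g w) powr p)"
    by (rule set_integrable_cong) (simp_all add: assms(2))
  ultimately show "f \<in> bergman_space \<Omega> p \<longleftrightarrow> g \<in> bergman_space \<Omega> p"
    by (simp add: bergman_space_def)
  have "(LINT w:\<Omega>|lborel. cmod (f w) powr p) = (LINT w:\<Omega>|lborel. cmod (g w) powr p)"
    using assms by (intro set_lebesgue_integral_cong) auto
  then show "Lp_norm \<Omega> p f = Lp_norm \<Omega> p g" by (simp add: Lp_norm_def)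
qed

lemma Lp_integral_scale:
  "(LINT w:\<Omega>|lborel. cmod (c * f w) powr p) = cmod c powr p * (LINT w:\<Omega>|lborel. cmod (f w) powr p)"
  by (simp add: norm_mult powr_mult)

lemma bergman_space_scale:
  assumes "f \<in> bergman_space \<Omega> p" shows "(\<lambda>w. c * f w) \<in> bergman_space \<Omega> p"
  using assms mholomorphic_on_mult[OF mholomorphic_on_const]
  by (auto simp: bergman_space_def norm_mult powr_mult)

lemma Lp_integral_nonneg: "(LINT w:\<Omega>|lborel. cmod (f w) powr p) \<ge> 0"
  unfolding set_lebesgue_integral_def by (intro Bochner_Integration.integral_nonneg) auto

lemma Lp_norm_scale:
  assumes "p > 0" shows "Lp_norm \<Omega> p (\<lambda>w. c * f w) = cmod c * Lp_norm \<Omega> p f"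
  unfolding Lp_norm_def Lp_integral_scale using assms Lp_integral_nonneg[of \<Omega> f p]
  by (simp add: powr_mult powr_powr)

lemma bergman_space_continuous_on_closure:
  assumes "bounded \<Omega>" "open \<Omega>" "f mholomorphic_on \<Omega>" "continuous_on (closure \<Omega>) f" "p > 0"
  shows "f \<in> bergman_space \<Omega> p"
proof -
  have "continuous_on (closure \<Omega>) (\<lambda>w. cmod (f w) powr p)"
    using assms by (intro continuous_on_powr' continuous_intros) auto
  then have "set_integrable lborel (closure \<Omega>) (\<lambda>w. cmod (f w) powr p)"
    unfolding set_integrable_def using assms by (intro borel_integrable_compact) auto
  then have "set_integrable lborel \<Omega> (\<lambda>w. cmod (f w) powr p)"
    by (rule set_integrable_subset) (use assms closure_subset in auto)
  then show ?thesis using assms by (simp add: bergman_space_def)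
qed

text \<open>
  A normalised coordinate function, shifted to vanish at \<open>z\<close>. Only the positivity of its norm needs an argument.
\<close>

lemma extremal_values_nonempty:
  fixes \<Omega> :: "(complex ^ 'n) set"
  assumes \<Omega>: "bounded_domain \<Omega>" "z \<in> \<Omega>" and p: "p > 0"
  shows "\<exists>f. f \<in> bergman_space \<Omega> p \<and> f z = 0 \<and> Lp_norm \<Omega> p f = 1"
proof -
  have op: "open \<Omega>" and bd: "bounded \<Omega>" using \<Omega> by (auto simp: bounded_domain_def)
  define j :: 'n where "j = undefined"
  define f where "f w = w $ j + - (z $ j)" for w :: "complex ^ 'n"
  have "f mholomorphic_on \<Omega>" unfolding f_def
    by (intro mholomorphic_on_add mholomorphic_on_component mholomorphic_on_const)
  then have f: "f \<in> bergman_space \<Omega> p"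
    by (intro bergman_space_continuous_on_closure bd op p) (auto simp: f_def intro!: continuous_intros)
  obtain r C where r: "r > 0" "cball z r \<subseteq> \<Omega>"
    and C: "\<And>f w. f \<in> bergman_space \<Omega> p \<Longrightarrow> (LINT u:\<Omega>|lborel. cmod (f u) powr p) \<le> 1 \<Longrightarrow>
      w \<in> cball z r \<Longrightarrow> cmod (f w) \<le> C"
    by (rule Lp_ball_locally_bounded[OF p op \<Omega>(2)]) blast
  have "Lp_norm \<Omega> p f \<noteq> 0"
  proof
    assume "Lp_norm \<Omega> p f = 0"
    then have "(LINT u:\<Omega>|lborel. cmod (f u) powr p) = 0" by (simp add: Lp_norm_def)
    \<comment> \<open>If the norm were zero, all multiples of \<open>f\<close> would obey the same local bound \<open>C\<close>, although \<open>f\<close> is \<open>r\<close> at some point of the ball.\<close>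
    then have 0: "(LINT u:\<Omega>|lborel. cmod (of_real c * f u) powr p) \<le> 1" for c :: real
      by (simp only: Lp_integral_scale)
    let ?w = "z + of_real r *s axis j 1"
    have w: "?w \<in> cball z r" using r by (simp add: dist_norm norm_vector_smult norm_axis_1)
    have fw: "f ?w = of_real r" by (simp add: f_def)
    have "cmod (of_real ((C + 1) / r) * f ?w) \<le> C"
      by (rule C[OF bergman_space_scale[OF f] 0 w])
    then have "\<bar>C + 1\<bar> \<le> C" using r by (simp add: fw norm_mult norm_divide)
    then show False by linarith
  qed
  then have n: "Lp_norm \<Omega> p f > 0" using Lp_norm_def by (metis less_eq_real_def powr_ge_zero)
  show ?thesis
  proof (intro exI conjI)
    show "(\<lambda>w. of_real (inverse (Lp_norm \<Omega> p f)) * f w) \<in> bergman_space \<Omega> p"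
      by (rule bergman_space_scale[OF f])
    show "of_real (inverse (Lp_norm \<Omega> p f)) * f z = 0" by (simp add: f_def)
    show "Lp_norm \<Omega> p (\<lambda>w. of_real (inverse (Lp_norm \<Omega> p f)) * f w) = 1"
      unfolding Lp_norm_scale[OF p] using n by (simp add: norm_inverse)
  qed
qed

text \<open>
  The real supremum in the metric commutes with scaling only on nonempty sets that are bounded above; this and the
  previous lemma ensure it.
\<close>

lemma extremal_values_bdd_above:
  fixes \<Omega> :: "(complex ^ 'n) set"
  assumes "open \<Omega>" "z \<in> \<Omega>" and p: "p > 0"
  shows "bdd_above {cmod (vec_apply X f z) | f. f \<in> bergman_space \<Omega> p \<and> f z = 0 \<and> Lp_norm \<Omega> p f = 1}"
proof -
  obtain r C where r: "r > 0" "cball z r \<subseteq> \<Omega>"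
    and C: "\<And>f w. f \<in> bergman_space \<Omega> p \<Longrightarrow> (LINT u:\<Omega>|lborel. cmod (f u) powr p) \<le> 1 \<Longrightarrow>
      w \<in> cball z r \<Longrightarrow> cmod (f w) \<le> C"
    by (rule Lp_ball_locally_bounded[OF p assms(1,2)]) blast
  have "cmod (vec_apply X f z) \<le> C * (norm X + 1) / r"
    if f: "f \<in> bergman_space \<Omega> p" and n: "Lp_norm \<Omega> p f = 1" for f
  proof (rule vec_apply_bound[OF _ r])
    show "f mholomorphic_on \<Omega>" using f by (simp add: bergman_space_def)
    have "((LINT u:\<Omega>|lborel. cmod (f u) powr p) powr (1 / p)) powr p = 1"
      using n by (simp add: Lp_norm_def)
    then have "(LINT u:\<Omega>|lborel. cmod (f u) powr p) = 1"
      using p Lp_integral_nonneg[of \<Omega> f p] by (simp add: powr_powr)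
    then show "cmod (f w) \<le> C" if "w \<in> cball z r" for w
      using C[OF f _ that] by simp
  qed
  then show ?thesis by (auto simp: bdd_above_def)
qed

lemma Sup_image_scale:
  fixes S :: "real set"
  assumes "c \<ge> 0" "S \<noteq> {}" "bdd_above S"
  shows "Sup ((\<lambda>x. c * x) ` S) = c * Sup S"
  using assms by (intro continuous_at_Sup_mono[symmetric]) (auto simp: mono_def mult_left_mono intro!: continuous_intros)

lemma Inf_image_scale:
  fixes S :: "real set"
  assumes "c \<ge> 0" "S \<noteq> {}" "bdd_below S"
  shows "Inf ((\<lambda>x. c * x) ` S) = c * Inf S"
  using assms by (intro continuous_at_Inf_mono[symmetric]) (auto simp: mono_def mult_left_mono intro!: continuous_intros)

lemma Lp_norm_nonneg: "Lp_norm \<Omega> p f \<ge> 0"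
  by (simp add: Lp_norm_def)

lemma bergman_m_candidates:
  fixes \<Omega> :: "(complex ^ 'n) set"
  assumes "bounded_domain \<Omega>" "p > 0"
  shows "{Lp_norm \<Omega> p f | f. f \<in> bergman_space \<Omega> p \<and> f z = 1} \<noteq> {}"
    and "bdd_below {Lp_norm \<Omega> p f | f. f \<in> bergman_space \<Omega> p \<and> f z = 1}"
proof -
  have "(\<lambda>_. 1) \<in> bergman_space \<Omega> p"
    using assms by (intro bergman_space_continuous_on_closure) (auto simp: bounded_domain_def)
  then show "{Lp_norm \<Omega> p f | f. f \<in> bergman_space \<Omega> p \<and> f z = 1} \<noteq> {}" by fastforce
  show "bdd_below {Lp_norm \<Omega> p f | f. f \<in> bergman_space \<Omega> p \<and> f z = 1}"
    using Lp_norm_nonneg by (auto intro!: bdd_belowI[of _ 0])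
qed

lemma bergman_K_powr:
  assumes "bounded_domain \<Omega>" "p > 0"
  shows "bergman_K \<Omega> p z powr (- 1 / p) = bergman_m \<Omega> p z"
proof -
  have "bergman_m \<Omega> p z \<ge> 0"
    unfolding bergman_m_def by (rule cInf_greatest[OF bergman_m_candidates(1)[OF assms]]) (auto simp: Lp_norm_nonneg)
  then show ?thesis using assms(2) by (simp add: bergman_K_def powr_powr)
qed

section \<open>The isometry of Bergman spaces and invariance of the metric\<close>

text \<open>
  For \<open>\<bar>g\<bar>\<^sup>p = \<bar>J\<bar>\<^sup>2\<close> this is the isometry from \<open>A\<^sup>p(\<Omega>2)\<close> onto \<open>A\<^sup>p(\<Omega>1)\<close>.
\<close>

definition weighted_pullback ::
    "(complex ^ 'n \<Rightarrow> complex ^ 'n) \<Rightarrow> (complex ^ 'n \<Rightarrow> complex) \<Rightarrow> (complex ^ 'n \<Rightarrow> complex) \<Rightarrow> complex ^ 'n \<Rightarrow> complex" where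
  "weighted_pullback F g f z = f (F z) * g z"

context
  fixes F :: "complex ^ 'n \<Rightarrow> complex ^ 'n" and \<Omega>1 \<Omega>2 :: "(complex ^ 'n) set"
    and g :: "complex ^ 'n \<Rightarrow> complex" and p :: real
  assumes p: "p > 0" and \<Omega>1: "bounded_domain \<Omega>1" and \<Omega>2: "bounded_domain \<Omega>2"
    and F: "biholomorphic_map F \<Omega>1 \<Omega>2"
    and g: "g mholomorphic_on \<Omega>1"
    and g_det: "\<And>z. z \<in> \<Omega>1 \<Longrightarrow> cmod (g z) powr p = cmod (det (jacobian F z)) ^ 2"
begin

lemma open_domains: "open \<Omega>1" "open \<Omega>2"
  using \<Omega>1 \<Omega>2 by (auto simp: bounded_domain_def)

lemma biholomorphic_facts:
  "inj_on F \<Omega>1" "F ` \<Omega>1 = \<Omega>2" "holomorphic_map_on F \<Omega>1" "holomorphic_map_on (inv_into \<Omega>1 F) \<Omega>2"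
  using F by (auto simp: biholomorphic_map_def bij_betw_def)

lemma g_nonzero: "z \<in> \<Omega>1 \<Longrightarrow> g z \<noteq> 0"
  using g_det det_jacobian_nonzero[OF open_domains(1) F] by fastforce

lemma weighted_pullback_mholomorphic:
  assumes "f mholomorphic_on \<Omega>2" shows "weighted_pullback F g f mholomorphic_on \<Omega>1"
  unfolding weighted_pullback_def[abs_def]
  using biholomorphic_facts(2)
  by (intro mholomorphic_on_mult mholomorphic_on_compose_map(1)[OF assms biholomorphic_facts(3)] g) simp

text \<open>
  The factor \<open>\<bar>g\<bar>\<^sup>p = \<bar>J\<bar>\<^sup>2\<close> is exactly the density in the change of variables.
\<close>

lemma weighted_pullback_isometry:
  assumes f: "f mholomorphic_on \<Omega>2"
  shows "weighted_pullback F g f \<in> bergman_space \<Omega>1 p \<longleftrightarrow> f \<in> bergman_space \<Omega>2 p"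
    and "Lp_norm \<Omega>1 p (weighted_pullback F g f) = Lp_norm \<Omega>2 p f"
proof -
  let ?h = "\<lambda>w. cmod (f w) powr p"
  have cont: "continuous_on \<Omega>2 ?h"
    using p by (intro continuous_on_powr' continuous_on_norm mholomorphic_on_imp_continuous_on[OF f] continuous_on_const) auto
  have contF: "continuous_on \<Omega>1 F"
    using holomorphic_map_has_derivative[OF biholomorphic_facts(3)]
    by (meson continuous_at_imp_continuous_on has_derivative_continuous)
  have contJ: "continuous_on \<Omega>1 (\<lambda>z. det (jacobian F z))"
    by (rule mholomorphic_on_imp_continuous_on[OF mholomorphic_on_det_jacobian[OF open_domains(1) biholomorphic_facts(3)]])
  have cont': "continuous_on \<Omega>1 (\<lambda>z. cmod (det (jacobian F z)) ^ 2 * ?h (F z))"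
    by (intro continuous_intros contJ continuous_on_compose2[OF cont contF]) (simp add: biholomorphic_facts)
  have eq: "cmod (weighted_pullback F g f z) powr p = cmod (det (jacobian F z)) ^ 2 * ?h (F z)" if "z \<in> \<Omega>1" for z
    using g_det[OF that] by (simp add: weighted_pullback_def norm_mult powr_mult)
  have der: "(F has_derivative (*v) (jacobian F z)) (at z)" if "z \<in> \<Omega>1" for z
    using holomorphic_map_has_derivative[OF biholomorphic_facts(3) that] by (simp add: jacobian_mult_vector[abs_def])
  have meas: "set_borel_measurable borel (F ` \<Omega>1) ?h"
    "set_borel_measurable borel \<Omega>1 (\<lambda>z. cmod (det (jacobian F z)) ^ 2 * ?h (F z))"
    unfolding biholomorphic_facts(2)
    using open_domains by (auto intro!: continuous_on_imp_set_borel_measurable cont cont')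
  note cov = complex_change_of_variables[OF borel_open[OF open_domains(1)] biholomorphic_facts(1) der meas, unfolded biholomorphic_facts(2)]
  have "set_integrable lborel \<Omega>1 (\<lambda>z. cmod (weighted_pullback F g f z) powr p) \<longleftrightarrow>
      set_integrable lborel \<Omega>1 (\<lambda>z. cmod (det (jacobian F z)) ^ 2 * ?h (F z))"
    by (rule set_integrable_cong) (simp_all add: eq)
  also have "\<dots> \<longleftrightarrow> set_integrable lborel \<Omega>2 ?h"
    by (rule cov(1)[symmetric])
  finally have "set_integrable lborel \<Omega>1 (\<lambda>z. cmod (weighted_pullback F g f z) powr p) \<longleftrightarrow> set_integrable lborel \<Omega>2 ?h" .
  then show "weighted_pullback F g f \<in> bergman_space \<Omega>1 p \<longleftrightarrow> f \<in> bergman_space \<Omega>2 p"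
    using weighted_pullback_mholomorphic[OF f] f by (simp add: bergman_space_def)
  have "(LINT z:\<Omega>1|lborel. cmod (weighted_pullback F g f z) powr p) =
      (LINT z:\<Omega>1|lborel. cmod (det (jacobian F z)) ^ 2 * ?h (F z))"
    using open_domains eq by (intro set_lebesgue_integral_cong) auto
  also have "\<dots> = (LINT w:\<Omega>2|lborel. ?h w)"
    by (rule cov(2)[symmetric])
  finally have "(LINT z:\<Omega>1|lborel. cmod (weighted_pullback F g f z) powr p) = (LINT w:\<Omega>2|lborel. ?h w)" .
  then show "Lp_norm \<Omega>1 p (weighted_pullback F g f) = Lp_norm \<Omega>2 p f"
    by (simp add: Lp_norm_def)
qed

lemma weighted_pullback_in:
  assumes "f \<in> bergman_space \<Omega>2 p"
  shows "weighted_pullback F g f \<in> bergman_space \<Omega>1 p" "Lp_norm \<Omega>1 p (weighted_pullback F g f) = Lp_norm \<Omega>2 p f"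
  using assms weighted_pullback_isometry[of f] by (auto simp: bergman_space_def)

text \<open>
  The preimage of \<open>f1\<close> is \<open>(f1 / g) \<circ> F\<^sup>-\<^sup>1\<close>, which is holomorphic because \<open>g\<close> has no zeros.
\<close>

lemma weighted_pullback_surj:
  assumes f1: "f1 \<in> bergman_space \<Omega>1 p"
  obtains f where "f \<in> bergman_space \<Omega>2 p" "\<And>z. z \<in> \<Omega>1 \<Longrightarrow> f1 z = weighted_pullback F g f z"
    "Lp_norm \<Omega>2 p f = Lp_norm \<Omega>1 p f1"
proof -
  let ?G = "inv_into \<Omega>1 F"
  define f where "f w = f1 (?G w) * inverse (g (?G w))" for w
  have "(\<lambda>z. f1 z * inverse (g z)) mholomorphic_on \<Omega>1"
    using f1 by (intro mholomorphic_on_mult mholomorphic_on_inverse g g_nonzero) (simp_all add: bergman_space_def)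
  moreover have "?G ` \<Omega>2 \<subseteq> \<Omega>1"
    unfolding biholomorphic_facts(2)[symmetric] using biholomorphic_facts(1) by auto
  ultimately have f: "f mholomorphic_on \<Omega>2"
    unfolding f_def[abs_def] by (rule mholomorphic_on_compose_map(1)[OF _ biholomorphic_facts(4)])
  have eq: "f1 z = weighted_pullback F g f z" if "z \<in> \<Omega>1" for z
    using that g_nonzero biholomorphic_facts(1) by (simp add: weighted_pullback_def f_def)
  note cong = bergman_space_cong[OF open_domains(1) eq]
  show thesis
  proof (rule that)
    show "f \<in> bergman_space \<Omega>2 p"
      using f1 by (simp only: cong(1) weighted_pullback_isometry(1)[OF f])
    show "Lp_norm \<Omega>2 p f = Lp_norm \<Omega>1 p f1"
      by (simp only: cong(2) weighted_pullback_isometry(2)[OF f])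
  qed (rule eq)
qed

text \<open>
  At a zero of \<open>f \<circ> F\<close> the derivative of \<open>g\<close> drops out of the product rule.
\<close>

lemma vec_apply_weighted_pullback:
  assumes "f mholomorphic_on \<Omega>2" "z \<in> \<Omega>1" "f (F z) = 0"
  shows "vec_apply X (weighted_pullback F g f) z = vec_apply (push_forward F z X) f (F z) * g z"
proof -
  have sub: "F ` \<Omega>1 \<subseteq> \<Omega>2" using biholomorphic_facts by simp
  note comp = mholomorphic_on_compose_map[OF assms(1) biholomorphic_facts(3) sub]
  show ?thesis
    unfolding weighted_pullback_def[abs_def] vec_apply_mult[OF comp(1) g assms(2)] comp(2)[OF assms(2)]
    using assms(3) by simp
qed

text \<open>
  Competitors with value 1 correspond after multiplication by the constant \<open>g z\<close> or its inverse.
\<close>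

lemma bergman_m_pullback:
  assumes z: "z \<in> \<Omega>1"
  shows "bergman_m \<Omega>1 p z = inverse (cmod (g z)) * bergman_m \<Omega>2 p (F z)"
proof -
  let ?A1 = "{Lp_norm \<Omega>1 p f | f. f \<in> bergman_space \<Omega>1 p \<and> f z = 1}"
  let ?A2 = "{Lp_norm \<Omega>2 p f | f. f \<in> bergman_space \<Omega>2 p \<and> f (F z) = 1}"
  let ?c = "inverse (cmod (g z))"
  have nz: "g z \<noteq> 0" using g_nonzero z .
  have "?A1 = (\<lambda>x. ?c * x) ` ?A2"
  proof (intro equalityI subsetI)
    fix x assume "x \<in> ?A1"
    then obtain f1 where f1: "f1 \<in> bergman_space \<Omega>1 p" "f1 z = 1" "x = Lp_norm \<Omega>1 p f1" by blast
    obtain f where f: "f \<in> bergman_space \<Omega>2 p" "\<And>z. z \<in> \<Omega>1 \<Longrightarrow> f1 z = weighted_pullback F g f z"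
      "Lp_norm \<Omega>2 p f = Lp_norm \<Omega>1 p f1"
      by (rule weighted_pullback_surj[OF f1(1)]) blast
    have "(\<lambda>w. g z * f w) \<in> bergman_space \<Omega>2 p"
      by (rule bergman_space_scale[OF f(1)])
    moreover have "g z * f (F z) = 1"
      using f(2)[OF z] f1(2) by (simp add: weighted_pullback_def mult.commute)
    moreover have "x = ?c * Lp_norm \<Omega>2 p (\<lambda>w. g z * f w)"
      using nz by (simp add: Lp_norm_scale[OF p] f(3) f1(3))
    ultimately show "x \<in> (\<lambda>x. ?c * x) ` ?A2" by blast
  next
    fix x assume "x \<in> (\<lambda>x. ?c * x) ` ?A2"
    then obtain f where f: "f \<in> bergman_space \<Omega>2 p" "f (F z) = 1" "x = ?c * Lp_norm \<Omega>2 p f" by blast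
    have "(\<lambda>u. inverse (g z) * weighted_pullback F g f u) \<in> bergman_space \<Omega>1 p"
      by (rule bergman_space_scale[OF weighted_pullback_in(1)[OF f(1)]])
    moreover have "inverse (g z) * weighted_pullback F g f z = 1"
      using nz f(2) by (simp add: weighted_pullback_def)
    moreover have "x = Lp_norm \<Omega>1 p (\<lambda>u. inverse (g z) * weighted_pullback F g f u)"
      by (simp add: Lp_norm_scale[OF p] f(3) norm_inverse weighted_pullback_in(2)[OF f(1)])
    ultimately show "x \<in> ?A1" by blast
  qed
  then show ?thesis
    unfolding bergman_m_def
    using Inf_image_scale[of ?c, OF _ bergman_m_candidates[OF \<Omega>2 p]] by simp
qed

lemma extremal_Sup_pullback:
  assumes z: "z \<in> \<Omega>1"
  shows "Sup {cmod (vec_apply X f z) | f. f \<in> bergman_space \<Omega>1 p \<and> f z = 0 \<and> Lp_norm \<Omega>1 p f = 1} =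
    cmod (g z) * Sup {cmod (vec_apply (push_forward F z X) f (F z)) | f.
      f \<in> bergman_space \<Omega>2 p \<and> f (F z) = 0 \<and> Lp_norm \<Omega>2 p f = 1}"
    (is "Sup ?S1 = _ * Sup ?S2")
proof -
  have nz: "g z \<noteq> 0" using g_nonzero z .
  have Fz: "F z \<in> \<Omega>2" using z biholomorphic_facts(2) by blast
  have "?S1 = (\<lambda>x. cmod (g z) * x) ` ?S2"
  proof (intro equalityI subsetI)
    fix x assume "x \<in> ?S1"
    then obtain f1 where f1: "f1 \<in> bergman_space \<Omega>1 p" "f1 z = 0" "Lp_norm \<Omega>1 p f1 = 1"
      "x = cmod (vec_apply X f1 z)" by blast
    obtain f where f: "f \<in> bergman_space \<Omega>2 p" "\<And>z. z \<in> \<Omega>1 \<Longrightarrow> f1 z = weighted_pullback F g f z"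
      "Lp_norm \<Omega>2 p f = Lp_norm \<Omega>1 p f1"
      by (rule weighted_pullback_surj[OF f1(1)]) blast
    have 0: "f (F z) = 0" using f(2)[OF z] f1(2) nz by (simp add: weighted_pullback_def)
    have "vec_apply X f1 z = vec_apply X (weighted_pullback F g f) z"
      by (rule vec_apply_cong[OF open_domains(1) z _ f(2)]) (use f1 in \<open>simp add: bergman_space_def\<close>)
    also have "\<dots> = vec_apply (push_forward F z X) f (F z) * g z"
      using f(1) z 0 by (intro vec_apply_weighted_pullback) (auto simp: bergman_space_def)
    finally have "x = cmod (g z) * cmod (vec_apply (push_forward F z X) f (F z))"
      by (simp add: f1(4) norm_mult)
    with 0 f f1(3) show "x \<in> (\<lambda>x. cmod (g z) * x) ` ?S2" by auto
  next
    fix x assume "x \<in> (\<lambda>x. cmod (g z) * x) ` ?S2"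
    then obtain f where f: "f \<in> bergman_space \<Omega>2 p" "f (F z) = 0" "Lp_norm \<Omega>2 p f = 1"
      "x = cmod (g z) * cmod (vec_apply (push_forward F z X) f (F z))" by blast
    have "x = cmod (vec_apply X (weighted_pullback F g f) z)"
      using f z by (subst vec_apply_weighted_pullback) (auto simp: bergman_space_def norm_mult)
    moreover have "weighted_pullback F g f z = 0" using f(2) by (simp add: weighted_pullback_def)
    ultimately show "x \<in> ?S1" using weighted_pullback_in[OF f(1)] f(3) by auto
  qed
  moreover have "?S2 \<noteq> {}" using extremal_values_nonempty[OF \<Omega>2 Fz p] by blast
  ultimately show ?thesis
    using Sup_image_scale[of "cmod (g z)" ?S2] extremal_values_bdd_above[OF open_domains(2) Fz p] by simp
qed

lemma bergman_B_invariant: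
  assumes z: "z \<in> \<Omega>1"
  shows "bergman_B \<Omega>1 p z X = bergman_B \<Omega>2 p (F z) (push_forward F z X)"
  using g_nonzero[OF z]
  unfolding bergman_B_def bergman_K_powr[OF \<Omega>1 p] bergman_K_powr[OF \<Omega>2 p]
    bergman_m_pullback[OF z] extremal_Sup_pullback[OF z]
  by simp

end

theorem proposition2p18:
  fixes p :: real
    and \<Omega>1 \<Omega>2 :: "(complex ^ 'n) set"
    and F :: "complex ^ 'n \<Rightarrow> complex ^ 'n"
  assumes "p > 0"
    and "bounded_domain \<Omega>1" and "bounded_domain \<Omega>2"
    and "biholomorphic_map F \<Omega>1 \<Omega>2"
  shows "(simply_connected \<Omega>1 \<and> simply_connected \<Omega>2 \<longrightarrow>
            (\<forall>z\<in>\<Omega>1. \<forall>X :: complex ^ 'n.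
               bergman_B \<Omega>1 p z X = bergman_B \<Omega>2 p (F z) (push_forward F z X)))
       \<and> ((\<exists>m::nat. m > 0 \<and> 2 / p = real m) \<longrightarrow>
            (\<forall>z\<in>\<Omega>1. \<forall>X :: complex ^ 'n.
               bergman_B \<Omega>1 p z X = bergman_B \<Omega>2 p (F z) (push_forward F z X)))"
proof -
  have op: "open \<Omega>1" using assms(2) by (simp add: bounded_domain_def)
  let ?J = "\<lambda>z. det (jacobian F z)"
  have J: "?J mholomorphic_on \<Omega>1"
    using assms(4) by (intro mholomorphic_on_det_jacobian op) (simp add: biholomorphic_map_def)
  have nz: "?J z \<noteq> 0" if "z \<in> \<Omega>1" for z
    by (rule det_jacobian_nonzero[OF op assms(4) that])
  note inv = bergman_B_invariant[OF assms]
  show ?thesis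
  proof (intro conjI impI ballI allI)
    fix z X assume "simply_connected \<Omega>1 \<and> simply_connected \<Omega>2" and z: "z \<in> \<Omega>1"
    then obtain g where "g mholomorphic_on \<Omega>1" "\<And>z. z \<in> \<Omega>1 \<Longrightarrow> cmod (g z) powr p = cmod (?J z) ^ 2"
      using holomorphic_root_simply_connected[OF op _ J nz assms(1)] by blast
    then show "bergman_B \<Omega>1 p z X = bergman_B \<Omega>2 p (F z) (push_forward F z X)"
      by (rule inv[OF _ _ z])
  next
    fix z X assume "\<exists>m::nat. m > 0 \<and> 2 / p = real m" and z: "z \<in> \<Omega>1"
    then obtain m where "2 / p = real m" by blast
    then obtain g where "g mholomorphic_on \<Omega>1" "\<And>z. z \<in> \<Omega>1 \<Longrightarrow> cmod (g z) powr p = cmod (?J z) ^ 2"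
      using holomorphic_root_integer_exponent[OF J nz assms(1)] by blast
    then show "bergman_B \<Omega>1 p z X = bergman_B \<Omega>2 p (F z) (push_forward F z X)"
      by (rule inv[OF _ _ z])
  qed
qed

end
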